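(* Let $d\ge1$, $\varrho>0$ and $\mu>-\frac12$. For $n=0,1,2,\ldots$, every $u\in\mathcal V_n^E(\mathbb V^{d+1},W_{\frac12,\mu})$ satisfies $$\Big[\Big(1-\frac{\varrho^2}{t^2}\Big)\partial_t^2+\Delta_x+\frac2t\langle x,\nabla_x\rangle\partial_t-\frac2t(t^2-\varrho^2)\partial_t-2\langle x,\nabla_x\rangle+\frac1t\Big(\frac{\varrho^2}{t^2}+2\mu+d\Big)\partial_t\Big]u=-2n\,u .$$
   Context: $\mathbb V^{d+1}=\{(x,t)\in\mathbb R^d\times\mathbb R:\ \|x\|^2\le t^2-\varrho^2,\ |t|\ge\varrho\}$ is the infinite solid double hyperboloid and $W_{\frac12,\mu}(x,t)=|t|\,e^{-t^2}(t^2-\varrho^2-\|x\|^2)^{\mu-\frac12}$. $\mathcal V_n^E(\mathbb V^{d+1},W)$ is the space of polynomials in $(x,t)$ of degree at most $n$ that are even in $t$ and orthogonal to all polynomials of degree at most $n-1$ with respect to $\langle f,g\rangle_W=\int_{\mathbb V^{d+1}}f\,g\,W\,dx\,dt$. $\Delta_x,\nabla_x$ act on $x\in\mathbb R^d$; $\langle x,\nabla_x\rangle=\sum_ix_i\partial_{x_i}$; $\partial_t$ is the derivative in $t$ with $x$ fixed. The identity holds for $t\ne0$. *)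

theory Defs
  imports "HOL-Analysis.Analysis"
begin

text \<open>
  Points of \<open>\<real>\<^sup>d \<times> \<real>\<close> are pairs \<open>(x, t)\<close> of type \<open>(real ^ 'd) \<times> real\<close>, where
  \<open>d = CARD('d) \<ge> 1\<close>. Polynomials are treated as functions on the whole space.
\<close>

definition multi_indices :: "nat \<Rightarrow> (('d::finite \<Rightarrow> nat) \<times> nat) set" where
  "multi_indices n = {(\<alpha>, k). (\<Sum>i\<in>UNIV. \<alpha> i) + k \<le> n}"

lemma finite_multi_indices: "finite (multi_indices n :: (('d::finite \<Rightarrow> nat) \<times> nat) set)"
proof (rule finite_subset)
  show "(multi_indices n :: (('d \<Rightarrow> nat) \<times> nat) set) \<subseteq> PiE UNIV (\<lambda>_. {..n}) \<times> {..n}"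
  proof
    fix z :: "('d \<Rightarrow> nat) \<times> nat"
    assume z: "z \<in> multi_indices n"
    obtain \<alpha> k where zk: "z = (\<alpha>, k)" by (cases z)
    have s: "(\<Sum>i\<in>UNIV. \<alpha> i) + k \<le> n" using z zk by (simp add: multi_indices_def)
    have "\<alpha> i \<le> n" for i
    proof -
      have "\<alpha> i \<le> (\<Sum>i\<in>UNIV. \<alpha> i)" by (rule member_le_sum) auto
      then show ?thesis using s by linarith
    qed
    then show "z \<in> PiE UNIV (\<lambda>_. {..n}) \<times> {..n}" using s zk by auto
  qed
  show "finite (PiE (UNIV :: 'd set) (\<lambda>_. {..n}) \<times> {..n})"
    by (intro finite_cartesian_product finite_PiE) auto
qed

text \<open>Real polynomials in \<open>(x, t)\<close> of total degree at most \<open>n\<close>.\<close>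

definition polys :: "nat \<Rightarrow> ((real ^ 'd::finite) \<times> real \<Rightarrow> real) set" where
  "polys n = {p. \<exists>c. \<forall>x t. p (x, t) =
     (\<Sum>(\<alpha>, k)\<in>multi_indices n. c (\<alpha>, k) * ((\<Prod>i\<in>UNIV. (x $ i) ^ \<alpha> i) * t ^ k))}"

definition hyperboloid :: "real \<Rightarrow> ((real ^ 'd::finite) \<times> real) set" where
  "hyperboloid \<rho> = {(x, t). (norm x)\<^sup>2 \<le> t\<^sup>2 - \<rho>\<^sup>2 \<and> \<bar>t\<bar> \<ge> \<rho>}"

text \<open>
  Where \<open>t\<^sup>2 - \<rho>\<^sup>2 = \<parallel>x\<parallel>\<^sup>2\<close> (a null set), the \<open>powr\<close> factor takes the value \<open>0\<close>.
\<close>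

definition W_half :: "real \<Rightarrow> real \<Rightarrow> (real ^ 'd::finite) \<times> real \<Rightarrow> real" where
  "W_half \<rho> \<mu> = (\<lambda>(x, t). \<bar>t\<bar> * exp (- t\<^sup>2) * (t\<^sup>2 - \<rho>\<^sup>2 - (norm x)\<^sup>2) powr (\<mu> - 1/2))"

definition inner_W ::
  "real \<Rightarrow> ((real ^ 'd::finite) \<times> real \<Rightarrow> real) \<Rightarrow> ((real ^ 'd) \<times> real \<Rightarrow> real)
     \<Rightarrow> ((real ^ 'd) \<times> real \<Rightarrow> real) \<Rightarrow> real" where
  "inner_W \<rho> W f g = set_lebesgue_integral lborel (hyperboloid \<rho>) (\<lambda>z. f z * g z * W z)"

text \<open>
  \<open>V\<^sub>n\<^sup>E\<close>. Polynomials of degree at most \<open>n - 1\<close> are those in some \<open>polys m\<close> with \<open>m < n\<close>;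
  this makes the orthogonality condition vacuous for \<open>n = 0\<close>.
\<close>

definition V_even ::
  "real \<Rightarrow> ((real ^ 'd::finite) \<times> real \<Rightarrow> real) \<Rightarrow> nat
     \<Rightarrow> ((real ^ 'd) \<times> real \<Rightarrow> real) set" where
  "V_even \<rho> W n = {u \<in> polys n. (\<forall>x t. u (x, - t) = u (x, t)) \<and>
     (\<forall>m<n. \<forall>q\<in>polys m. inner_W \<rho> W u q = 0)}"

definition pd_t ::
  "((real ^ 'd::finite) \<times> real \<Rightarrow> real) \<Rightarrow> (real ^ 'd) \<times> real \<Rightarrow> real" where
  "pd_t u = (\<lambda>(x, t). deriv (\<lambda>s. u (x, s)) t)"

definition pd_x ::
  "'d::finite \<Rightarrow> ((real ^ 'd) \<times> real \<Rightarrow> real) \<Rightarrow> (real ^ 'd) \<times> real \<Rightarrow> real" where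
  "pd_x i u = (\<lambda>(x, t). deriv (\<lambda>s. u (x + s *\<^sub>R axis i 1, t)) 0)"

definition laplace_x ::
  "((real ^ 'd::finite) \<times> real \<Rightarrow> real) \<Rightarrow> (real ^ 'd) \<times> real \<Rightarrow> real" where
  "laplace_x u z = (\<Sum>i\<in>UNIV. pd_x i (pd_x i u) z)"

text \<open>The operator \<open>\<langle>x, \<nabla>\<^sub>x\<rangle>\<close>.\<close>

definition euler_x ::
  "((real ^ 'd::finite) \<times> real \<Rightarrow> real) \<Rightarrow> (real ^ 'd) \<times> real \<Rightarrow> real" where
  "euler_x u z = (\<Sum>i\<in>UNIV. fst z $ i * pd_x i u z)"

end

theory Submission
  imports Defs "HOL-Probability.Distributions"
begin

text \<open>
  In the coordinates \<open>(x, r)\<close> with \<open>r = t\<^sup>2 - \<rho>\<^sup>2 - \<parallel>x\<parallel>\<^sup>2\<close>, a polynomial even in \<open>t\<close> becomes a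
  polynomial \<open>P\<close> in \<open>(x, r)\<close> in which \<open>r\<close> has weight 2, and the weight function becomes the product
  \<open>exp (-\<parallel>x\<parallel>\<^sup>2) r powr (\<mu> - 1/2) exp (- r)\<close> of Hermite and Laguerre weights. The differential operator
  becomes \<open>D = \<Delta> - 2 \<langle>x, \<nabla>\<rangle> + 4 (r \<partial>\<^sub>r\<^sup>2 + (\<mu> + 1/2 - r) \<partial>\<^sub>r)\<close>. It is symmetric, and \<open>D + 2 n\<close> lowers
  the weighted degree of polynomials of degree at most \<open>n\<close>. So if \<open>P\<close> is orthogonal to all lower degrees and
  \<open>v = (D + 2 n) P\<close>, then \<open>\<langle>v, v\<rangle> = \<langle>P, (D + 2 n) v\<rangle> = 0\<close>, whence \<open>v = 0\<close>.
\<close>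

section \<open>Weighted polynomials\<close>

text \<open>
  Here \<open>w\<close> is the weight of the last variable and \<open>d\<close> bounds the weighted degree. Degrees are
  integers, with only \<open>0\<close> in negative degree, so that lowering the degree needs no case distinction.
\<close>

inductive wpoly :: "int \<Rightarrow> int \<Rightarrow> ((real ^ 'd::finite) \<times> real \<Rightarrow> real) \<Rightarrow> bool" for w :: int where
  zero: "wpoly w d (\<lambda>_. 0)"
| const: "0 \<le> d \<Longrightarrow> wpoly w d (\<lambda>_. c)"
| coord: "wpoly w d f \<Longrightarrow> wpoly w (d + 1) (\<lambda>z. fst z $ i * f z)"
| last: "wpoly w d f \<Longrightarrow> wpoly w (d + w) (\<lambda>z. snd z * f z)"
| add: "wpoly w d f \<Longrightarrow> wpoly w d g \<Longrightarrow> wpoly w d (\<lambda>z. f z + g z)"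

lemma wpoly_mono: "wpoly w d f \<Longrightarrow> d \<le> d' \<Longrightarrow> wpoly w d' f"
proof (induction arbitrary: d' rule: wpoly.induct)
  case (coord d f i)
  then show ?case using wpoly.coord[of w "d' - 1" f i] by simp
next
  case (last d f)
  then show ?case using wpoly.last[of w "d' - w" f] by simp
qed (auto intro: wpoly.intros)

lemma wpoly_coordI: "wpoly w (d - 1) f \<Longrightarrow> wpoly w d (\<lambda>z. fst z $ i * f z)"
  using wpoly.coord[of w "d - 1" f i] by simp

lemma wpoly_lastI: "wpoly w (d - w) f \<Longrightarrow> wpoly w d (\<lambda>z. snd z * f z)"
  using wpoly.last[of w "d - w" f] by simp

text \<open>Multiplication by a variable never decreases the degree when \<open>0 \<le> w\<close>,
  so nothing but \<open>zero\<close> and sums of zeros can reach a negative degree. This settles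
  \<open>n = 0\<close> in the theorem, where the orthogonality condition is vacuous.\<close>

lemma wpoly_negD: "wpoly w d f \<Longrightarrow> 0 \<le> w \<Longrightarrow> d < 0 \<Longrightarrow> f = (\<lambda>_. 0)"
  by (induction rule: wpoly.induct) auto

lemma wpoly_cmult: "wpoly w d f \<Longrightarrow> wpoly w d (\<lambda>z. c * f z)"
proof (induction rule: wpoly.induct)
  case (coord d f i)
  then show ?case using wpoly.coord[of w d "\<lambda>z. c * f z" i] by (simp add: algebra_simps)
next
  case (last d f)
  then show ?case using wpoly.last[of w d "\<lambda>z. c * f z"] by (simp add: algebra_simps)
next
  case (add d f g)
  then show ?case using wpoly.add[of w d "\<lambda>z. c * f z" "\<lambda>z. c * g z"] by (simp add: algebra_simps)
qed (auto intro: wpoly.intros)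

lemma wpoly_diff: "wpoly w d f \<Longrightarrow> wpoly w d g \<Longrightarrow> wpoly w d (\<lambda>z. f z - g z)"
  using wpoly.add[of w d f "\<lambda>z. -1 * g z"] wpoly_cmult[of w d g "-1"] by simp

lemma wpoly_sum: "(\<And>i. i \<in> I \<Longrightarrow> wpoly w d (f i)) \<Longrightarrow> wpoly w d (\<lambda>z. \<Sum>i\<in>I. f i z)"
  by (induction I rule: infinite_finite_induct) (auto intro: wpoly.intros)

lemma wpoly_mult: "wpoly w d f \<Longrightarrow> 0 \<le> w \<Longrightarrow> wpoly w e g \<Longrightarrow> wpoly w (d + e) (\<lambda>z. f z * g z)"
proof (induction rule: wpoly.induct)
  case (const d c)
  then show ?case using wpoly_mono[of w e g "d + e"] by (simp add: wpoly_cmult)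
next
  case (coord d f i)
  then show ?case using wpoly.coord[of w "d + e" "\<lambda>z. f z * g z" i] by (simp add: algebra_simps)
next
  case (last d f)
  then show ?case using wpoly.last[of w "d + e" "\<lambda>z. f z * g z"] by (simp add: algebra_simps)
next
  case (add d f f')
  then show ?case using wpoly.add[of w "d + e" "\<lambda>z. f z * g z" "\<lambda>z. f' z * g z"]
    by (simp add: algebra_simps)
qed (auto intro: wpoly.intros)

lemma wpoly_power: "wpoly w d f \<Longrightarrow> 0 \<le> w \<Longrightarrow> wpoly w (int k * d) (\<lambda>z. f z ^ k)"
proof (induction k)
  case (Suc k)
  then show ?case using wpoly_mult[of w d f "int k * d" "\<lambda>z. f z ^ k"] by (simp add: algebra_simps)
qed (auto intro: wpoly.intros)

lemma wpoly_prod: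
  "(\<And>i. i \<in> I \<Longrightarrow> wpoly w (d i) (f i)) \<Longrightarrow> 0 \<le> w \<Longrightarrow> wpoly w (\<Sum>i\<in>I. d i) (\<lambda>z. \<Prod>i\<in>I. f i z)"
  by (induction I rule: infinite_finite_induct) (auto intro: wpoly.intros wpoly_mult)

lemma wpoly_fst: "wpoly w 1 (\<lambda>z. fst z $ i)"
  using wpoly_coordI[of w 1 "\<lambda>_. 1" i] wpoly.const[of 0 w 1] by simp

lemma wpoly_snd: "wpoly w w (\<lambda>z. snd z)"
  using wpoly_lastI[of w w "\<lambda>_. 1"] wpoly.const[of 0 w 1] by simp

lemma norm_vec_power2: "(norm (x :: real ^ 'd::finite))\<^sup>2 = (\<Sum>i\<in>UNIV. (x $ i)\<^sup>2)"
  by (simp add: norm_vec_def L2_set_def sum_nonneg)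

lemma wpoly_norm_power2: "0 \<le> w \<Longrightarrow> wpoly w 2 (\<lambda>z. (norm (fst z))\<^sup>2)"
  unfolding norm_vec_power2 using wpoly_power[OF wpoly_fst, of w 2]
  by (auto intro!: wpoly_sum)

section \<open>Monomial expansions and the link with polynomials of bounded total degree\<close>

definition monom_xs :: "('d::finite \<Rightarrow> nat) \<Rightarrow> nat \<Rightarrow> (real ^ 'd) \<times> real \<Rightarrow> real" where
  "monom_xs \<alpha> k z = (\<Prod>i\<in>UNIV. (fst z $ i) ^ \<alpha> i) * snd z ^ k"

definition wdeg :: "int \<Rightarrow> ('d::finite \<Rightarrow> nat) \<times> nat \<Rightarrow> int" where
  "wdeg w a = (\<Sum>i\<in>UNIV. int (fst a i)) + w * int (snd a)"

lemma wpoly_monom_xs: "0 \<le> w \<Longrightarrow> wpoly w (wdeg w (\<alpha>, k)) (monom_xs \<alpha> k)"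
  unfolding monom_xs_def wdeg_def fst_conv snd_conv
  using wpoly_power[OF wpoly_fst, of w] wpoly_power[OF wpoly_snd, of w k]
  by (intro wpoly_mult wpoly_prod) (simp_all add: mult.commute)

lemma coord_times_monom_xs:
  "fst z $ i * monom_xs \<alpha> k z = monom_xs (\<alpha>(i := Suc (\<alpha> i))) k z"
proof -
  have "(\<Prod>j\<in>UNIV. (fst z $ j) ^ (\<alpha>(i := Suc (\<alpha> i))) j)
      = (\<Prod>j\<in>UNIV. (if j = i then fst z $ i else 1) * (fst z $ j) ^ \<alpha> j)"
    by (intro prod.cong) auto
  then show ?thesis by (simp add: monom_xs_def prod.distrib prod.delta)
qed

lemma last_times_monom_xs: "snd z * monom_xs \<alpha> k z = monom_xs \<alpha> (Suc k) z"
  by (simp add: monom_xs_def)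

lemma wdeg_Suc: "wdeg w (\<alpha>(i := Suc (\<alpha> i)), k) = wdeg w (\<alpha>, k) + 1"
proof -
  have "(\<Sum>j\<in>UNIV. int ((\<alpha>(i := Suc (\<alpha> i))) j)) = (\<Sum>j\<in>UNIV. (if j = i then 1 else 0) + int (\<alpha> j))"
    by (intro sum.cong) auto
  then show ?thesis by (simp add: wdeg_def sum.distrib sum.delta)
qed

text \<open>Follows the construction of \<open>f\<close>: multiplication by a variable shifts
  exponents, and a sum merges two index sets. The expansion links \<open>wpoly\<close> with
  \<open>polys\<close> and allows linear identities to be checked on monomials alone.\<close>

lemma wpoly_monom_expansion:
  fixes f :: "(real ^ 'd::finite) \<times> real \<Rightarrow> real"
  assumes "wpoly w d f"
  shows "\<exists>A c. finite A \<and> (\<forall>a\<in>A. wdeg w a \<le> d) \<and> (\<forall>z. f z = (\<Sum>a\<in>A. c a * monom_xs (fst a) (snd a) z))"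
  using assms
proof (induction rule: wpoly.induct)
  case (zero d)
  show ?case by (rule exI[of _ "{}"]) auto
next
  case (const d c)
  then show ?case
    by (intro exI[of _ "{(\<lambda>_. 0, 0)}"] exI[of _ "\<lambda>_. c"]) (auto simp: wdeg_def monom_xs_def)
next
  case (coord d f i)
  then obtain A c where A: "finite A" "\<forall>a\<in>A. wdeg w a \<le> d"
    "\<And>z. f z = (\<Sum>a\<in>A. c a * monom_xs (fst a) (snd a) z)" by blast
  \<comment> \<open>The effect of the factor \<open>x $ i\<close> on exponents. It is injective, so
    the coefficients are transported along its inverse.\<close>
  define h where "h = (\<lambda>a :: ('d \<Rightarrow> nat) \<times> nat. ((fst a)(i := Suc (fst a i)), snd a))"
  have inj: "inj_on h A"
  proof (rule inj_onI)
    fix a b assume eq: "h a = h b"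
    have "fst a j = fst b j" for j
      using arg_cong[OF eq, of "\<lambda>b. fst b j"] by (simp add: h_def split: if_splits)
    then show "a = b" using eq by (auto simp: h_def prod_eq_iff)
  qed
  have "fst z $ i * f z = (\<Sum>a\<in>h ` A. c (the_inv_into A h a) * monom_xs (fst a) (snd a) z)" for z
    by (subst sum.reindex[OF inj])
      (simp add: A(3) sum_distrib_left coord_times_monom_xs[symmetric] h_def the_inv_into_f_f[OF inj, unfolded h_def]
        mult.left_commute)
  moreover have "\<forall>a\<in>h ` A. wdeg w a \<le> d + 1"
    using A(2) by (auto simp: h_def wdeg_Suc)
  ultimately show ?case using A(1)
    by (intro exI[of _ "h ` A"] exI[of _ "\<lambda>a. c (the_inv_into A h a)"]) auto
next
  case (last d f)
  then obtain A c where A: "finite A" "\<forall>a\<in>A. wdeg w a \<le> d"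
    "\<And>z. f z = (\<Sum>a\<in>A. c a * monom_xs (fst a) (snd a) z)" by blast
  define h where "h = (\<lambda>a :: ('d \<Rightarrow> nat) \<times> nat. (fst a, Suc (snd a)))"
  have inj: "inj_on h A"
    by (intro inj_onI) (auto simp: h_def prod_eq_iff)
  have "snd z * f z = (\<Sum>a\<in>h ` A. c (the_inv_into A h a) * monom_xs (fst a) (snd a) z)" for z
    by (subst sum.reindex[OF inj])
      (simp add: A(3) sum_distrib_left last_times_monom_xs[symmetric] h_def the_inv_into_f_f[OF inj, unfolded h_def]
        mult.left_commute)
  moreover have "\<forall>a\<in>h ` A. wdeg w a \<le> d + w"
    using A(2) by (auto simp: h_def wdeg_def algebra_simps)
  ultimately show ?case using A(1)
    by (intro exI[of _ "h ` A"] exI[of _ "\<lambda>a. c (the_inv_into A h a)"]) auto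
next
  case (add d f g)
  then obtain A c B b where A: "finite A" "\<forall>a\<in>A. wdeg w a \<le> d"
    "\<And>z. f z = (\<Sum>a\<in>A. c a * monom_xs (fst a) (snd a) z)"
    and B: "finite B" "\<forall>a\<in>B. wdeg w a \<le> d"
    "\<And>z. g z = (\<Sum>a\<in>B. b a * monom_xs (fst a) (snd a) z)" by blast
  \<comment> \<open>The index sets of the summands may overlap, so both coefficient families are
    extended by 0 to the union before they are added.\<close>
  define c' where "c' a = (if a \<in> A then c a else 0) + (if a \<in> B then b a else 0)" for a
  have "f z + g z = (\<Sum>a\<in>A \<union> B. c' a * monom_xs (fst a) (snd a) z)" for z
  proof -
    have "(\<Sum>a\<in>A \<union> B. (if a \<in> A then c a else 0) * monom_xs (fst a) (snd a) z) = f z"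
      unfolding A(3) using A(1) B(1) by (intro sum.mono_neutral_cong_right) auto
    moreover have "(\<Sum>a\<in>A \<union> B. (if a \<in> B then b a else 0) * monom_xs (fst a) (snd a) z) = g z"
      unfolding B(3) using A(1) B(1) by (intro sum.mono_neutral_cong_right) auto
    ultimately show ?thesis by (simp add: c'_def distrib_right sum.distrib)
  qed
  then show ?case using A(1,2) B(1,2)
    by (intro exI[of _ "A \<union> B"] exI[of _ c']) auto
qed

text \<open>For weight 1 the weighted degree is the total degree. A monomial expansion then becomes
  the defining sum of \<open>polys\<close> once the missing multi-indices receive coefficient
  0.\<close>

lemma polys_iff_wpoly: "p \<in> polys n \<longleftrightarrow> wpoly 1 (int n) p"
proof
  assume "p \<in> polys n"
  then obtain c where c: "\<And>x t. p (x, t) =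
     (\<Sum>(\<alpha>, k)\<in>multi_indices n. c (\<alpha>, k) * ((\<Prod>i\<in>UNIV. (x $ i) ^ \<alpha> i) * t ^ k))"
    unfolding polys_def by blast
  have p: "p = (\<lambda>z. \<Sum>a\<in>multi_indices n. c a * monom_xs (fst a) (snd a) z)"
    by (auto simp: fun_eq_iff c monom_xs_def case_prod_unfold)
  show "wpoly 1 (int n) p" unfolding p
  proof (intro wpoly_sum wpoly_cmult)
    fix a :: "('a \<Rightarrow> nat) \<times> nat" assume "a \<in> multi_indices n"
    then have "wdeg 1 a \<le> int n"
      by (auto simp: multi_indices_def wdeg_def simp flip: of_nat_sum of_nat_add)
    then show "wpoly 1 (int n) (monom_xs (fst a) (snd a))"
      using wpoly_monom_xs[of 1 "fst a" "snd a"] by (auto intro: wpoly_mono)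
  qed
next
  assume "wpoly 1 (int n) p"
  from wpoly_monom_expansion[OF this] obtain A c where A: "finite A" "\<forall>a\<in>A. wdeg 1 a \<le> int n"
    "\<forall>z. p z = (\<Sum>a\<in>A. c a * monom_xs (fst a) (snd a) z)"
    by (elim exE conjE)
  have sub: "A \<subseteq> multi_indices n"
  proof
    fix a assume "a \<in> A"
    with A(2) have "int ((\<Sum>i\<in>UNIV. fst a i) + snd a) \<le> int n"
      by (simp add: wdeg_def)
    then show "a \<in> multi_indices n"
      unfolding multi_indices_def case_prod_unfold of_nat_le_iff by simp
  qed
  have "p (x, t) = (\<Sum>(\<alpha>, k)\<in>multi_indices n.
      (if (\<alpha>, k) \<in> A then c (\<alpha>, k) else 0) * ((\<Prod>i\<in>UNIV. (x $ i) ^ \<alpha> i) * t ^ k))" for x t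
    unfolding A(3)[rule_format] by (intro sum.mono_neutral_cong_left finite_multi_indices sub)
      (auto simp: monom_xs_def case_prod_unfold)
  then show "p \<in> polys n"
    unfolding polys_def by (intro CollectI exI[of _ "\<lambda>a. if a \<in> A then c a else 0"]) blast
qed

section \<open>Partial derivatives of polynomials\<close>

lemma wpoly_differentiable: "wpoly w d f \<Longrightarrow> f differentiable (at z)"
proof (induction rule: wpoly.induct)
  case (coord d f i)
  have "(\<lambda>z :: (real ^ 'a) \<times> real. fst z $ i) differentiable (at z)"
    by (intro bounded_linear_imp_differentiable bounded_linear_vec_nth[THEN bounded_linear_compose] bounded_linear_fst)
  then show ?case using coord by (intro differentiable_mult)
next
  case (last d f)
  have "(\<lambda>z :: (real ^ 'a) \<times> real. snd z) differentiable (at z)"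
    by (intro bounded_linear_imp_differentiable bounded_linear_snd)
  then show ?case using last by (intro differentiable_mult)
qed (auto intro: differentiable_add)

text \<open>The partial derivatives are values of the Frechet derivative on basis vectors, so that
  the sum, product and chain rules below can be read off from the Frechet rules.\<close>

lemma partials_has_derivative:
  fixes f :: "(real ^ 'd::finite) \<times> real \<Rightarrow> real"
  assumes "(f has_derivative f') (at z)"
  shows "pd_x i f z = f' (axis i 1, 0)" "pd_t f z = f' (0, 1)"
proof -
  obtain x t where z: "z = (x, t)" by (cases z)
  interpret bounded_linear f' using assms by (rule has_derivative_bounded_linear)
  have "((\<lambda>s. f (x + s *\<^sub>R axis i 1, t)) has_derivative (\<lambda>s. f' (s *\<^sub>R axis i 1, 0))) (at 0)"
    by (rule has_derivative_compose[of "\<lambda>s. (x + s *\<^sub>R axis i 1, t)" "\<lambda>s. (s *\<^sub>R axis i 1, 0)"])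
      (use assms in \<open>auto simp: z intro!: derivative_eq_intros\<close>)
  moreover have "(\<lambda>s. f' (s *\<^sub>R axis i 1, 0)) = (*) (f' (axis i 1, 0))"
  proof (rule ext)
    fix s show "f' (s *\<^sub>R axis i 1, 0) = f' (axis i 1, 0) * s"
      using scaleR[of s "(axis i 1, 0)"] by (simp add: mult.commute)
  qed
  ultimately show "pd_x i f z = f' (axis i 1, 0)"
    unfolding pd_x_def z by (simp add: DERIV_imp_deriv has_field_derivative_def)
  have "((\<lambda>s. f (x, s)) has_derivative (\<lambda>s. f' (0, s))) (at t)"
    by (rule has_derivative_compose[of "\<lambda>s. (x, s)" "\<lambda>s. (0, s)"])
      (use assms in \<open>auto simp: z intro!: derivative_eq_intros\<close>)
  moreover have "(\<lambda>s. f' (0, s)) = (*) (f' (0, 1))"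
  proof (rule ext)
    fix s show "f' (0, s) = f' (0, 1) * s" using scaleR[of s "(0, 1)"] by (simp add: mult.commute)
  qed
  ultimately show "pd_t f z = f' (0, 1)"
    unfolding pd_t_def z by (simp add: DERIV_imp_deriv has_field_derivative_def)
qed

text \<open>A linear map is determined by its values on the standard basis. This form of the
  derivative is what the chain rule for \<open>hyp_coords\<close> requires.\<close>

lemma has_derivative_partials:
  fixes f :: "(real ^ 'd::finite) \<times> real \<Rightarrow> real"
  assumes "f differentiable (at z)"
  shows "(f has_derivative (\<lambda>h. (\<Sum>i\<in>UNIV. fst h $ i * pd_x i f z) + snd h * pd_t f z)) (at z)"
proof -
  obtain f' where f': "(f has_derivative f') (at z)" using assms by (auto simp: differentiable_def)
  interpret bounded_linear f' using f' by (rule has_derivative_bounded_linear)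
  have "f' h = (\<Sum>i\<in>UNIV. fst h $ i * pd_x i f z) + snd h * pd_t f z" for h
  proof -
    have "h = (\<Sum>i\<in>UNIV. fst h $ i *\<^sub>R (axis i 1, 0)) + snd h *\<^sub>R (0, 1)"
      by (auto simp: prod_eq_iff fst_sum snd_sum basis_expansion scalar_mult_eq_scaleR[symmetric])
    then have "f' h = f' ((\<Sum>i\<in>UNIV. fst h $ i *\<^sub>R (axis i 1, 0)) + snd h *\<^sub>R (0, 1))"
      by (rule arg_cong)
    also have "\<dots> = (\<Sum>i\<in>UNIV. fst h $ i * pd_x i f z) + snd h * pd_t f z"
      unfolding add sum scaleR partials_has_derivative[OF f'] by simp
    finally show ?thesis .
  qed
  then have "f' = (\<lambda>h. (\<Sum>i\<in>UNIV. fst h $ i * pd_x i f z) + snd h * pd_t f z)" by (rule ext)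
  then show ?thesis using f' by simp
qed

lemma partials_add:
  assumes "f differentiable (at z)" "g differentiable (at z)"
  shows "pd_x i (\<lambda>z. f z + g z) z = pd_x i f z + pd_x i g z"
    and "pd_t (\<lambda>z. f z + g z) z = pd_t f z + pd_t g z"
proof -
  obtain f' g' where D: "(f has_derivative f') (at z)" "(g has_derivative g') (at z)"
    using assms by (auto simp: differentiable_def)
  note partials_has_derivative[OF has_derivative_add[OF D]] partials_has_derivative[OF D(1)]
    partials_has_derivative[OF D(2)]
  then show "pd_x i (\<lambda>z. f z + g z) z = pd_x i f z + pd_x i g z"
    and "pd_t (\<lambda>z. f z + g z) z = pd_t f z + pd_t g z" by simp_all
qed

lemma partials_diff:
  assumes "f differentiable (at z)" "g differentiable (at z)"
  shows "pd_x i (\<lambda>z. f z - g z) z = pd_x i f z - pd_x i g z"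
    and "pd_t (\<lambda>z. f z - g z) z = pd_t f z - pd_t g z"
proof -
  obtain f' g' where D: "(f has_derivative f') (at z)" "(g has_derivative g') (at z)"
    using assms by (auto simp: differentiable_def)
  note partials_has_derivative[OF has_derivative_diff[OF D]] partials_has_derivative[OF D(1)]
    partials_has_derivative[OF D(2)]
  then show "pd_x i (\<lambda>z. f z - g z) z = pd_x i f z - pd_x i g z"
    and "pd_t (\<lambda>z. f z - g z) z = pd_t f z - pd_t g z" by simp_all
qed

lemma partials_mult:
  assumes "f differentiable (at z)" "g differentiable (at z)"
  shows "pd_x i (\<lambda>z. f z * g z) z = f z * pd_x i g z + pd_x i f z * g z"
    and "pd_t (\<lambda>z. f z * g z) z = f z * pd_t g z + pd_t f z * g z"
proof -
  obtain f' g' where D: "(f has_derivative f') (at z)" "(g has_derivative g') (at z)"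
    using assms by (auto simp: differentiable_def)
  note partials_has_derivative[OF has_derivative_mult[OF D]] partials_has_derivative[OF D(1)]
    partials_has_derivative[OF D(2)]
  then show "pd_x i (\<lambda>z. f z * g z) z = f z * pd_x i g z + pd_x i f z * g z"
    and "pd_t (\<lambda>z. f z * g z) z = f z * pd_t g z + pd_t f z * g z" by simp_all
qed

lemma partials_const: "pd_x i (\<lambda>_. c) = (\<lambda>_. 0)" "pd_t (\<lambda>_. c) = (\<lambda>_. 0)"
  using partials_has_derivative[OF has_derivative_const] by blast+

lemma partials_fst:
  "pd_x i (\<lambda>z. fst z $ j) z = (if i = j then 1 else 0)" "pd_t (\<lambda>z. fst z $ j) z = 0"
proof -
  have "((\<lambda>z :: (real ^ 'a) \<times> real. fst z $ j) has_derivative (\<lambda>z. fst z $ j)) (at z)"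
    by (intro bounded_linear_imp_has_derivative bounded_linear_vec_nth[THEN bounded_linear_compose] bounded_linear_fst)
  note partials_has_derivative[OF this]
  then show "pd_x i (\<lambda>z. fst z $ j) z = (if i = j then 1 else 0)" "pd_t (\<lambda>z. fst z $ j) z = 0"
    by (auto simp: axis_def)
qed

lemma partials_snd: "pd_x i (\<lambda>z. snd z) z = 0" "pd_t (\<lambda>z. snd z) z = 1"
proof -
  have "((\<lambda>z :: (real ^ 'a) \<times> real. snd z) has_derivative (\<lambda>z. snd z)) (at z)"
    by (intro bounded_linear_imp_has_derivative bounded_linear_snd)
  note partials_has_derivative[OF this]
  then show "pd_x i (\<lambda>z. snd z) z = 0" "pd_t (\<lambda>z. snd z) z = 1" by auto
qed

lemmas differentiable_fst_nth = wpoly_differentiable[OF wpoly_fst]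
  and differentiable_snd_proj = wpoly_differentiable[OF wpoly_snd]

text \<open>Differentiating a variable in a product removes it and hence its weight. Integer degrees
  avoid an exception for constants, whose derivative is \<open>zero\<close> in any degree.\<close>

lemma wpoly_partials:
  assumes "wpoly w d f"
  shows "wpoly w (d - 1) (pd_x i f)" "wpoly w (d - w) (pd_t f)"
proof -
  have "wpoly w (d - 1) (pd_x i f) \<and> wpoly w (d - w) (pd_t f)" using assms
  proof (induction rule: wpoly.induct)
    case (coord d f j)
    have x: "pd_x i (\<lambda>z. fst z $ j * f z) = (\<lambda>z. fst z $ j * pd_x i f z + (if i = j then 1 else 0) * f z)"
      and t: "pd_t (\<lambda>z. fst z $ j * f z) = (\<lambda>z. fst z $ j * pd_t f z)"
      using wpoly_differentiable[OF coord(1)]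
      by (auto simp: fun_eq_iff partials_mult differentiable_fst_nth partials_fst)
    show ?case unfolding x t using coord
      by (intro conjI wpoly.add wpoly_cmult wpoly_coordI) (simp_all add: algebra_simps)
  next
    case (last d f)
    have x: "pd_x i (\<lambda>z. snd z * f z) = (\<lambda>z. snd z * pd_x i f z)"
      and t: "pd_t (\<lambda>z. snd z * f z) = (\<lambda>z. snd z * pd_t f z + f z)"
      using wpoly_differentiable[OF last(1)]
      by (auto simp: fun_eq_iff partials_mult differentiable_snd_proj partials_snd)
    show ?case unfolding x t using last
      by (intro conjI wpoly.add wpoly_lastI) (simp_all add: algebra_simps)
  next
    case (add d f g)
    have x: "pd_x i (\<lambda>z. f z + g z) = (\<lambda>z. pd_x i f z + pd_x i g z)"
      and t: "pd_t (\<lambda>z. f z + g z) = (\<lambda>z. pd_t f z + pd_t g z)"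
      using add(1,2)[THEN wpoly_differentiable] by (simp_all add: fun_eq_iff partials_add del: split_paired_All)
    show ?case unfolding x t using add by (auto intro!: wpoly.add)
  qed (simp_all add: partials_const wpoly.zero)
  then show "wpoly w (d - 1) (pd_x i f)" "wpoly w (d - w) (pd_t f)" by auto
qed

text \<open>Both orders of differentiation obey the same product rule, so the equality propagates
  along the construction of \<open>f\<close>.\<close>

lemma partials_commute: "wpoly w d f \<Longrightarrow> pd_t (pd_x i f) z = pd_x i (pd_t f) z"
proof (induction arbitrary: z rule: wpoly.induct)
  case (coord d f j)
  note df = wpoly_differentiable[OF coord(1)]
    wpoly_differentiable[OF wpoly_partials(1)[OF coord(1)]]
    wpoly_differentiable[OF wpoly_partials(2)[OF coord(1)]]
  have x: "pd_x i (\<lambda>z. fst z $ j * f z) = (\<lambda>z. fst z $ j * pd_x i f z + (if i = j then 1 else 0) * f z)"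
    and t: "pd_t (\<lambda>z. fst z $ j * f z) = (\<lambda>z. fst z $ j * pd_t f z)"
    using df by (auto simp: fun_eq_iff partials_mult differentiable_fst_nth partials_fst)
  show ?case unfolding x t using df coord(2)
    by (simp add: partials_mult partials_add differentiable_fst_nth partials_fst partials_const differentiable_mult)
next
  case (last d f)
  note df = wpoly_differentiable[OF last(1)]
    wpoly_differentiable[OF wpoly_partials(1)[OF last(1)]]
    wpoly_differentiable[OF wpoly_partials(2)[OF last(1)]]
  have x: "pd_x i (\<lambda>z. snd z * f z) = (\<lambda>z. snd z * pd_x i f z)"
    and t: "pd_t (\<lambda>z. snd z * f z) = (\<lambda>z. snd z * pd_t f z + f z)"
    using df by (auto simp: fun_eq_iff partials_mult differentiable_snd_proj partials_snd)
  show ?case unfolding x t using df last(2)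
    by (simp add: partials_mult partials_add differentiable_snd_proj partials_snd partials_const differentiable_mult)
next
  case (add d f g)
  have x: "pd_x i (\<lambda>z. f z + g z) = (\<lambda>z. pd_x i f z + pd_x i g z)"
    and t: "pd_t (\<lambda>z. f z + g z) = (\<lambda>z. pd_t f z + pd_t g z)"
    using add(1,2)[THEN wpoly_differentiable] by (simp_all add: fun_eq_iff partials_add del: split_paired_All)
  show ?case unfolding x t using add
    by (simp add: partials_add wpoly_partials[THEN wpoly_differentiable])
qed (simp_all add: partials_const)

section \<open>Moments of the weight\<close>

definition gauss_moment :: "nat \<Rightarrow> real" where
  "gauss_moment a = (\<integral>x. exp (- x\<^sup>2) * x ^ a \<partial>lborel)"

lemma gauss_moment_even:
  "has_bochner_integral lborel (\<lambda>x. exp (- x\<^sup>2) * x ^ (2 * k))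
    (sqrt pi * (fact (2 * k) / (2 ^ (2 * k) * fact k)))"
  using has_bochner_integral_even_function[OF gaussian_moment_even_pos[of k]] by simp

lemma gauss_moment_odd:
  "has_bochner_integral lborel (\<lambda>x :: real. exp (- x\<^sup>2) * x ^ (2 * k + 1)) 0"
  using has_bochner_integral_odd_function[OF gaussian_moment_odd_pos[of k]] by simp

lemma integrable_gauss_moment: "integrable lborel (\<lambda>x :: real. exp (- x\<^sup>2) * x ^ a)"
proof (cases "even a")
  case True
  then obtain k where "a = 2 * k" by (elim evenE)
  then show ?thesis using gauss_moment_even[of k] by (auto intro: integrable.intros)
next
  case False
  then obtain k where "a = 2 * k + 1" by (elim oddE)
  then show ?thesis using gauss_moment_odd[of k] by (auto intro: integrable.intros)
qed

lemma gauss_moment_1: "gauss_moment (Suc 0) = 0"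
  using gauss_moment_odd[of 0] by (simp add: gauss_moment_def has_bochner_integral_integral_eq)

text \<open>The analytic content is that the derivative of
  \<open>x ^ (a + 1) * exp (- x\<^sup>2)\<close> integrates to 0. Here it is read off from the
  closed form for even \<open>a\<close>; for odd \<open>a\<close> both moments vanish.\<close>

lemma gauss_moment_rec: "2 * gauss_moment (Suc (Suc a)) = (real a + 1) * gauss_moment a"
proof (cases "even a")
  case True
  then obtain k where a: "a = 2 * k" by (elim evenE)
  have "fact (2 * Suc k) / (2 ^ (2 * Suc k) * fact (Suc k))
      = (2 * real k + 1) / 2 * (fact (2 * k) / (2 ^ (2 * k) * fact k))"
    by (simp add: divide_simps) (simp add: algebra_simps)
  then show ?thesis
    using gauss_moment_even[of k] gauss_moment_even[of "Suc k"]
    by (simp add: gauss_moment_def has_bochner_integral_integral_eq a)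
next
  case False
  then obtain k where a: "a = 2 * k + 1" by (elim oddE)
  then show ?thesis
    using gauss_moment_odd[of k] gauss_moment_odd[of "Suc k"]
    by (simp add: gauss_moment_def has_bochner_integral_integral_eq a)
qed

text \<open>Lebesgue measure on the vector type is the image of a product measure indexed by the
  basis vectors. In those coordinates the integrand is a product of functions of one variable each,
  and the integral factors.\<close>

lemma has_bochner_integral_vec_prod:
  fixes g :: "'d::finite \<Rightarrow> real \<Rightarrow> real"
  assumes g: "\<And>i. integrable lborel (g i)"
  shows "has_bochner_integral lborel (\<lambda>x :: real ^ 'd. \<Prod>i\<in>UNIV. g i (x $ i))
           (\<Prod>i\<in>UNIV. integral\<^sup>L lborel (g i))"
proof -
  interpret product_sigma_finite "\<lambda>_ :: real ^ 'd. lborel :: real measure" ..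
  let ?P = "PiM (Basis :: (real ^ 'd) set) (\<lambda>_. lborel :: real measure)"
  let ?T = "\<lambda>f. \<Sum>b\<in>(Basis :: (real ^ 'd) set). f b *\<^sub>R b"
  have bij: "bij_betw (\<lambda>i. axis i 1 :: real ^ 'd) UNIV Basis"
    by (auto simp: bij_betw_def inj_on_def axis_eq_axis Basis_vec_def)
  have comp: "?T f $ i = f (axis i 1)" for f i
  proof -
    have "?T f $ i = (\<Sum>j\<in>UNIV. (f (axis j 1) *\<^sub>R axis j 1 :: real ^ 'd)) $ i"
      by (simp add: sum.reindex_bij_betw[OF bij, symmetric])
    also have "\<dots> = (\<Sum>j\<in>UNIV. if j = i then f (axis j 1) else 0)"
      unfolding sum_component by (intro sum.cong) (auto simp: axis_def)
    finally show ?thesis by simp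
  qed
  have eq: "(\<Prod>i\<in>UNIV. g i (?T f $ i)) = (\<Prod>b\<in>Basis. g (axis_index b) (f b))" for f
    unfolding comp by (subst prod.reindex_bij_betw[OF bij, symmetric]) simp
  have eq': "(\<Prod>b\<in>(Basis :: (real ^ 'd) set). integral\<^sup>L lborel (g (axis_index b)))
      = (\<Prod>i\<in>UNIV. integral\<^sup>L lborel (g i))"
    by (subst prod.reindex_bij_betw[OF bij, symmetric]) simp
  have T: "?T \<in> measurable ?P borel" by measurable
  have [measurable]: "g i \<in> borel_measurable borel" for i
    using borel_measurable_integrable[OF g] by simp
  have meas: "(\<lambda>x :: real ^ 'd. \<Prod>i\<in>UNIV. g i (x $ i)) \<in> borel_measurable borel"
    by measurable
  have int: "integrable ?P (\<lambda>f. \<Prod>i\<in>UNIV. g i (?T f $ i))"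
    unfolding eq by (intro product_integrable_prod finite_Basis g)
  have val: "(\<integral>f. (\<Prod>i\<in>UNIV. g i (?T f $ i)) \<partial>?P) = (\<Prod>i\<in>UNIV. integral\<^sup>L lborel (g i))"
    unfolding eq by (subst product_integral_prod) (use g eq' in auto)
  show ?thesis
    unfolding lborel_eq[where 'a = "real ^ 'd"] has_bochner_integral_iff
    using int val by (simp add: integrable_distr_eq[OF T meas] integral_distr[OF T meas])
qed

lemma gauss_moment_vec:
  "has_bochner_integral lborel
    (\<lambda>x :: real ^ 'd::finite. exp (- (norm x)\<^sup>2) * (\<Prod>i\<in>UNIV. (x $ i) ^ \<alpha> i))
    (\<Prod>i\<in>UNIV. gauss_moment (\<alpha> i))"
proof -
  have "(\<Prod>i\<in>UNIV. exp (- (x $ i)\<^sup>2) * (x $ i) ^ \<alpha> i)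
      = exp (- (norm x)\<^sup>2) * (\<Prod>i\<in>UNIV. (x $ i) ^ \<alpha> i)" for x :: "real ^ 'd"
    by (simp add: prod.distrib norm_vec_power2 exp_sum[symmetric] sum_negf)
  then show ?thesis
    using has_bochner_integral_vec_prod[of "\<lambda>i x. exp (- x\<^sup>2) * x ^ \<alpha> i", OF integrable_gauss_moment]
    by (simp add: gauss_moment_def)
qed

text \<open>The substitution \<open>r = t\<^sup>2 - c\<close> on each half line turns this into the Gamma integral.\<close>

lemma radial_integral:
  assumes c: "0 \<le> c" and b: "0 < b"
  shows "has_bochner_integral lborel
    (\<lambda>t. indicator {t. c \<le> t\<^sup>2} t * (\<bar>t\<bar> * exp (- t\<^sup>2) * (t\<^sup>2 - c) powr (b - 1)))
    (exp (- c) * Gamma (b :: real))"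
proof -
  define f where "f = (\<lambda>r :: real. r powr (b - 1) / exp r)"
  let ?S = "{sqrt c<..}"
  have "(\<lambda>x. if x \<in> {0..} then f x else 0) = (\<lambda>x. if x \<in> {0<..} then f x else 0)"
    by (auto simp: f_def fun_eq_iff)
  then have "(f has_integral Gamma b) {0<..}"
    using Gamma_integral_real[OF b] unfolding f_def[symmetric]
    by (metis has_integral_restrict_UNIV)
  then have "f absolutely_integrable_on {0<..} \<and> integral {0<..} f = Gamma b"
    by (auto intro!: nonnegative_absolutely_integrable_1 simp: has_integral_iff f_def)
  moreover have img: "(\<lambda>t. t\<^sup>2 - c) ` ?S = {0<..}"
  proof (intro equalityI subsetI)
    fix r :: real assume "r \<in> {0<..}"
    then have "r = (sqrt (r + c))\<^sup>2 - c" "sqrt (r + c) \<in> ?S" using c by auto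
    then show "r \<in> (\<lambda>t. t\<^sup>2 - c) ` ?S" by blast
  next
    fix r :: real assume "r \<in> (\<lambda>t. t\<^sup>2 - c) ` ?S"
    then obtain t where "r = t\<^sup>2 - c" "sqrt c < t" by auto
    then show "r \<in> {0<..}"
      using c real_less_rsqrt[of c t] power_strict_mono[of "sqrt c" t 2] by auto
  qed
  moreover have "inj_on (\<lambda>t. t\<^sup>2 - c) ?S"
  proof (rule inj_onI)
    fix s t assume st: "s \<in> ?S" "t \<in> ?S" "s\<^sup>2 - c = t\<^sup>2 - c"
    have "0 \<le> sqrt c" using c by simp
    with st have "0 < s" "0 < t" by (auto simp del: real_sqrt_ge_0_iff)
    with st(3) show "s = t" by (simp add: power2_eq_iff_nonneg)
  qed
  ultimately have *: "(\<lambda>t. \<bar>2 * t\<bar> * f (t\<^sup>2 - c)) absolutely_integrable_on ?S \<and>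
      integral ?S (\<lambda>t. \<bar>2 * t\<bar> * f (t\<^sup>2 - c)) = Gamma b"
    by (subst has_absolute_integral_change_of_variables_1'[of ?S "\<lambda>t. t\<^sup>2 - c"])
      (auto intro!: derivative_eq_intros)
  define F where "F = (\<lambda>t. indicator {t. c \<le> t\<^sup>2} t * (\<bar>t\<bar> * exp (- t\<^sup>2) * (t\<^sup>2 - c) powr (b - 1)))"
  \<comment> \<open>The 2 is left from the Jacobian, and \<open>exp c\<close> from
    \<open>exp (- (t\<^sup>2 - c))\<close>. The integrands agree at the boundary
    \<open>t\<^sup>2 = c\<close> too, since the \<open>powr\<close> factor is 0 there.\<close>
  have ind: "indicator ?S t *\<^sub>R (\<bar>2 * t\<bar> * f (t\<^sup>2 - c)) = 2 * exp c * (indicator {0..} t *\<^sub>R F t)" for t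
  proof (cases "0 \<le> t \<and> c \<noteq> t\<^sup>2")
    case True
    then have "sqrt c < t \<longleftrightarrow> c \<le> t\<^sup>2"
      using c by (metis abs_of_nonneg order_le_less real_less_rsqrt real_sqrt_abs real_sqrt_le_iff real_sqrt_less_iff)
    then show ?thesis using True by (auto simp: f_def F_def indicator_def exp_diff exp_minus field_simps)
  next
    case False
    moreover have "\<not> sqrt c < t" if "t < 0" using c that by (meson less_asym' order_le_less_trans real_sqrt_ge_zero)
    ultimately show ?thesis by (auto simp: F_def indicator_def f_def)
  qed
  \<comment> \<open>The substitution rule speaks about the completed measure; Borel measurability
    brings the result back to \<open>lborel\<close>.\<close>
  have meas: "(\<lambda>t. indicator ?S t *\<^sub>R (\<bar>2 * t\<bar> * f (t\<^sup>2 - c))) \<in> borel_measurable lborel"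
    unfolding f_def by measurable
  have "has_bochner_integral lborel (\<lambda>t. indicator ?S t *\<^sub>R (\<bar>2 * t\<bar> * f (t\<^sup>2 - c))) (Gamma b)"
    using * set_lebesgue_integral_eq_integral(2)[OF conjunct1[OF *]]
    unfolding has_bochner_integral_iff set_integrable_def set_lebesgue_integral_def
      integrable_completion[OF meas] integral_completion[OF meas] by simp
  then have "has_bochner_integral lborel (\<lambda>t. 2 * exp c * (indicator {0..} t *\<^sub>R F t)) (Gamma b)"
    unfolding ind .
  from has_bochner_integral_mult_right[OF this, of "exp (- c) / 2"]
  have "has_bochner_integral lborel (\<lambda>t. indicator {0..} t *\<^sub>R F t) (exp (- c) / 2 * Gamma b)"
    by (simp add: exp_minus mult.assoc[symmetric])
  \<comment> \<open>\<open>F\<close> is even, and the second half line cancels the factor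
    1/2.\<close>
  from has_bochner_integral_even_function[OF this]
  have "has_bochner_integral lborel F (exp (- c) * Gamma b)"
    by (simp add: F_def indicator_def)
  then show ?thesis unfolding F_def .
qed

section \<open>Integrals over the hyperboloid of polynomials in the coordinates
  \<open>(x, r)\<close>\<close>

definition hyp_coords :: "real \<Rightarrow> (real ^ 'd::finite) \<times> real \<Rightarrow> (real ^ 'd) \<times> real" where
  "hyp_coords \<rho> z = (fst z, (snd z)\<^sup>2 - \<rho>\<^sup>2 - (norm (fst z))\<^sup>2)"

text \<open>Only \<open>F\<close> is written in the new coordinates; domain and weight stay in
  \<open>(x, t)\<close>. Integrals of this function are therefore directly comparable with
  \<open>inner_W\<close>.\<close>

definition hyp_weighted ::
  "real \<Rightarrow> real \<Rightarrow> ((real ^ 'd::finite) \<times> real \<Rightarrow> real) \<Rightarrow> (real ^ 'd) \<times> real \<Rightarrow> real" where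
  "hyp_weighted \<rho> \<mu> F z = indicator (hyperboloid \<rho>) z * (F (hyp_coords \<rho> z) * W_half \<rho> \<mu> z)"

lemma hyperboloid_iff:
  assumes "0 \<le> \<rho>"
  shows "(x, t) \<in> hyperboloid \<rho> \<longleftrightarrow> \<rho>\<^sup>2 + (norm x)\<^sup>2 \<le> t\<^sup>2"
proof -
  have "\<rho> \<le> \<bar>t\<bar>" if "\<rho>\<^sup>2 + (norm x)\<^sup>2 \<le> t\<^sup>2"
  proof -
    have "\<rho>\<^sup>2 \<le> \<bar>t\<bar>\<^sup>2" using that by (simp add: order_trans[OF _ that])
    then show ?thesis using assms by (meson abs_ge_zero power2_le_imp_le)
  qed
  then show ?thesis by (auto simp: hyperboloid_def)
qed

lemma measurable_hyp_weighted_monom: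
  "hyp_weighted \<rho> \<mu> (monom_xs \<alpha> k) \<in> borel_measurable (lborel :: ((real ^ 'd::finite) \<times> real) measure)"
proof -
  have "hyperboloid \<rho> = {z :: (real ^ 'd) \<times> real. (norm (fst z))\<^sup>2 \<le> (snd z)\<^sup>2 - \<rho>\<^sup>2 \<and> \<rho> \<le> \<bar>snd z\<bar>}"
    by (auto simp: hyperboloid_def)
  also have "closed \<dots>"
    by (intro closed_Collect_conj closed_Collect_le continuous_intros)
  finally have [measurable]: "hyperboloid \<rho> \<in> sets (borel :: ((real ^ 'd) \<times> real) measure)"
    by (rule borel_closed)
  have [measurable]: "(\<lambda>z :: (real ^ 'd) \<times> real. fst z) \<in> borel_measurable borel"
    "(\<lambda>z :: (real ^ 'd) \<times> real. snd z) \<in> borel_measurable borel"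
    "(\<lambda>z :: (real ^ 'd) \<times> real. fst z $ i) \<in> borel_measurable borel" for i
    by (intro borel_measurable_continuous_onI continuous_intros)+
  show ?thesis
    unfolding hyp_weighted_def hyp_coords_def monom_xs_def W_half_def case_prod_unfold
    by (simp, measurable)
qed

text \<open>For fixed \<open>x\<close>, \<open>radial_integral\<close> with
  \<open>c = \<rho>\<^sup>2 + (norm x)\<^sup>2\<close> and \<open>b = k + \<mu> + 1/2\<close>
  evaluates the integral over \<open>t\<close>. Its factor \<open>exp (- c)\<close> supplies the
  Gaussian weight for the remaining moments in \<open>x\<close>. The bound on \<mu> makes
  \<open>b\<close> positive for every \<open>k\<close>.\<close>

lemma hyp_weighted_monom:
  fixes \<alpha> :: "'d::finite \<Rightarrow> nat"
  assumes \<rho>: "0 < \<rho>" and \<mu>: "- (1/2) < \<mu>"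
  shows "has_bochner_integral lborel (hyp_weighted \<rho> \<mu> (monom_xs \<alpha> k))
    (exp (- \<rho>\<^sup>2) * (\<Prod>i\<in>UNIV. gauss_moment (\<alpha> i)) * Gamma (real k + \<mu> + 1/2))"
proof -
  define f where "f = hyp_weighted \<rho> \<mu> (monom_xs \<alpha> k)"
  define G where "G = Gamma (real k + \<mu> + 1/2)"
  define X where "X x = (\<Prod>i\<in>UNIV. (x $ i) ^ \<alpha> i)" for x :: "real ^ 'd"
  have G: "G \<ge> 0" unfolding G_def using \<mu> by (intro Gamma_real_nonneg) auto
  \<comment> \<open>At \<open>r = 0\<close> both sides are 0, even for \<open>k = 0\<close>, because
    \<open>powr\<close> vanishes at base 0.\<close>
  have pw: "r ^ k * r powr (\<mu> - 1/2) = r powr (real k + \<mu> + 1/2 - 1)"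
    if "0 \<le> r" for r :: real using that
    by (cases "r = 0") (simp_all add: powr_realpow[symmetric] powr_add[symmetric] add_diff_eq[symmetric])
  have f: "f (x, t) = X x * (indicator {t. \<rho>\<^sup>2 + (norm x)\<^sup>2 \<le> t\<^sup>2} t *
      (\<bar>t\<bar> * exp (- t\<^sup>2) * (t\<^sup>2 - (\<rho>\<^sup>2 + (norm x)\<^sup>2)) powr (real k + \<mu> + 1/2 - 1)))" for x t
  proof (cases "\<rho>\<^sup>2 + (norm x)\<^sup>2 \<le> t\<^sup>2")
    case True
    then have "(t\<^sup>2 - (\<rho>\<^sup>2 + (norm x)\<^sup>2)) powr (real k + \<mu> + 1/2 - 1)
        = (t\<^sup>2 - \<rho>\<^sup>2 - (norm x)\<^sup>2) ^ k * (t\<^sup>2 - \<rho>\<^sup>2 - (norm x)\<^sup>2) powr (\<mu> - 1/2)"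
      using pw[of "t\<^sup>2 - (\<rho>\<^sup>2 + (norm x)\<^sup>2)"] by (simp only: diff_diff_eq)
    with True \<rho> show ?thesis
      by (simp add: f_def X_def hyp_weighted_def hyperboloid_iff hyp_coords_def W_half_def monom_xs_def)
  next
    case False
    with \<rho> show ?thesis by (simp add: f_def hyp_weighted_def hyperboloid_iff)
  qed
  have sec: "has_bochner_integral lborel (\<lambda>t. f (x, t))
      (X x * (exp (- (\<rho>\<^sup>2 + (norm x)\<^sup>2)) * G))" for x
    unfolding f G_def using \<mu> by (intro has_bochner_integral_mult_right radial_integral) auto
  \<comment> \<open>Only \<open>X x\<close> can be negative, so the absolute value changes nothing
    else in the radial integral. This gives the hypothesis of Fubini's theorem.\<close>
  have sec_norm: "(\<integral>t. norm (f (x, t)) \<partial>lborel) = \<bar>X x\<bar> * (exp (- (\<rho>\<^sup>2 + (norm x)\<^sup>2)) * G)" for x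
  proof -
    have "norm (f (x, t)) = \<bar>X x\<bar> * (indicator {t. \<rho>\<^sup>2 + (norm x)\<^sup>2 \<le> t\<^sup>2} t *
        (\<bar>t\<bar> * exp (- t\<^sup>2) * (t\<^sup>2 - (\<rho>\<^sup>2 + (norm x)\<^sup>2)) powr (real k + \<mu> + 1/2 - 1)))" for t
      by (simp add: f abs_mult)
    then have "has_bochner_integral lborel (\<lambda>t. norm (f (x, t)))
      (\<bar>X x\<bar> * (exp (- (\<rho>\<^sup>2 + (norm x)\<^sup>2)) * G))"
      unfolding G_def using \<mu>
      by (simp only:) (intro has_bochner_integral_mult_right radial_integral, auto)
    then show ?thesis by (rule has_bochner_integral_integral_eq)
  qed
  note vec = gauss_moment_vec[of \<alpha>, folded X_def]
  have ex: "X x * (exp (- (\<rho>\<^sup>2 + (norm x)\<^sup>2)) * G) = exp (- \<rho>\<^sup>2) * G * (exp (- (norm x)\<^sup>2) * X x)" for x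
    by (simp add: exp_add[symmetric] mult_ac exp_diff exp_minus field_simps)
  have int: "integrable (lborel \<Otimes>\<^sub>M lborel) f"
  proof (rule lborel_pair.Fubini_integrable)
    show "f \<in> borel_measurable (lborel \<Otimes>\<^sub>M lborel)"
      unfolding lborel_prod f_def by (rule measurable_hyp_weighted_monom)
    have "\<bar>X x\<bar> * (exp (- (\<rho>\<^sup>2 + (norm x)\<^sup>2)) * G)
        = exp (- \<rho>\<^sup>2) * G * \<bar>exp (- (norm x)\<^sup>2) * X x\<bar>" for x
      by (simp add: abs_mult exp_diff exp_minus field_simps)
    moreover have "integrable lborel (\<lambda>x. exp (- \<rho>\<^sup>2) * G * \<bar>exp (- (norm x)\<^sup>2) * X x\<bar>)"
      using integrable.intros[OF vec] by simp
    ultimately show "integrable lborel (\<lambda>x. \<integral>t. norm (f (x, t)) \<partial>lborel)"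
      unfolding sec_norm by (simp only:)
    show "AE x in lborel. integrable lborel (\<lambda>t. f (x, t))"
      using integrable.intros[OF sec] by simp
  qed
  have "integral\<^sup>L (lborel \<Otimes>\<^sub>M lborel) f = (\<integral>x. \<integral>t. f (x, t) \<partial>lborel \<partial>lborel)"
    using lborel_pair.integral_fst'[OF int] by simp
  also have "\<dots> = exp (- \<rho>\<^sup>2) * G * (\<Prod>i\<in>UNIV. gauss_moment (\<alpha> i))"
    unfolding has_bochner_integral_integral_eq[OF sec] ex
    using has_bochner_integral_integral_eq[OF vec] by simp
  finally show ?thesis
    using int unfolding lborel_prod has_bochner_integral_iff f_def[symmetric] G_def[symmetric]
    by (simp add: mult_ac)
qed

text \<open>An induction principle for properties that are linear in \<open>f\<close>, such as
  integral identities. The empty sum is covered by a monomial with coefficient 0.\<close>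

lemma wpoly_monom_induct [consumes 1, case_names monom add]:
  assumes "wpoly w d f"
    and monom: "\<And>c \<alpha> k. \<Phi> (\<lambda>z. c * monom_xs \<alpha> k z)"
    and add: "\<And>f g. \<Phi> f \<Longrightarrow> \<Phi> g \<Longrightarrow> \<Phi> (\<lambda>z. f z + g z)"
  shows "\<Phi> f"
proof -
  have sum: "\<Phi> (\<lambda>z. \<Sum>a\<in>A. c a * monom_xs (fst a) (snd a) z)" if "finite A" for A c
    using that
  proof (induction A rule: finite_induct)
    case empty
    then show ?case using monom[of 0 "\<lambda>_. 0" 0] by simp
  next
    case (insert a A)
    then show ?case using add[OF monom insert.IH] by simp
  qed
  from wpoly_monom_expansion[OF assms(1)] obtain A c where A: "finite A"
    "\<forall>z. f z = (\<Sum>a\<in>A. c a * monom_xs (fst a) (snd a) z)"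
    by (elim exE conjE)
  then have "f = (\<lambda>z. \<Sum>a\<in>A. c a * monom_xs (fst a) (snd a) z)" by (intro ext) (rule spec)
  then show ?thesis using sum[OF A(1), of c] by (simp only:)
qed

lemma hyp_weighted_add:
  "hyp_weighted \<rho> \<mu> (\<lambda>z. f z + g z) = (\<lambda>z. hyp_weighted \<rho> \<mu> f z + hyp_weighted \<rho> \<mu> g z)"
  and hyp_weighted_diff:
  "hyp_weighted \<rho> \<mu> (\<lambda>z. f z - g z) = (\<lambda>z. hyp_weighted \<rho> \<mu> f z - hyp_weighted \<rho> \<mu> g z)"
  and hyp_weighted_cmult:
  "hyp_weighted \<rho> \<mu> (\<lambda>z. c * f z) = (\<lambda>z. c * hyp_weighted \<rho> \<mu> f z)"
  and hyp_weighted_sum: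
  "hyp_weighted \<rho> \<mu> (\<lambda>z. \<Sum>i\<in>I. F i z) = (\<lambda>z. \<Sum>i\<in>I. hyp_weighted \<rho> \<mu> (F i) z)"
  by (auto simp: hyp_weighted_def fun_eq_iff algebra_simps sum_distrib_left sum_distrib_right)

lemma integrable_hyp_weighted:
  assumes "0 < \<rho>" "- (1/2) < \<mu>" "wpoly w d f"
  shows "integrable lborel (hyp_weighted \<rho> \<mu> f)"
  using assms(3)
proof (induction rule: wpoly_monom_induct)
  case (monom c \<alpha> k)
  then show ?case
    using integrable.intros[OF hyp_weighted_monom[OF assms(1,2)], of \<alpha> k] by (simp add: hyp_weighted_cmult)
qed (simp add: hyp_weighted_add)

section \<open>Derivatives of monomials and integration by parts\<close>

lemma monom_xs_upd:
  "monom_xs (\<alpha>(i := m)) k z = (fst z $ i) ^ m * (\<Prod>j\<in>UNIV - {i}. (fst z $ j) ^ \<alpha> j) * snd z ^ k"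
  unfolding monom_xs_def by (subst prod.remove[of UNIV i]) (auto intro!: prod.cong)

text \<open>For \<open>\<alpha> i = 0\<close> the truncated exponent \<open>\<alpha> i - 1\<close>
  is harmless, since its coefficient is 0.\<close>

lemma pd_x_monom_xs: "pd_x i (monom_xs \<alpha> k) z = real (\<alpha> i) * monom_xs (\<alpha>(i := \<alpha> i - 1)) k z"
proof -
  obtain x t where z: "z = (x, t)" by (cases z)
  define C where "C = (\<Prod>j\<in>UNIV - {i}. (x $ j) ^ \<alpha> j) * t ^ k"
  have "monom_xs \<alpha> k (x + s *\<^sub>R axis i 1, t) = (x $ i + s) ^ \<alpha> i * C" for s
  proof -
    have "(\<Prod>j\<in>UNIV - {i}. ((x + s *\<^sub>R axis i 1) $ j) ^ \<alpha> j) = (\<Prod>j\<in>UNIV - {i}. (x $ j) ^ \<alpha> j)"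
      by (intro prod.cong) (auto simp: axis_def)
    then show ?thesis
      using monom_xs_upd[of \<alpha> i "\<alpha> i" k "(x + s *\<^sub>R axis i 1, t)"] by (simp add: C_def)
  qed
  moreover have "((\<lambda>s. (x $ i + s) ^ \<alpha> i * C) has_real_derivative
      real (\<alpha> i) * (x $ i) ^ (\<alpha> i - 1) * C) (at 0)"
    by (auto intro!: derivative_eq_intros)
  ultimately show ?thesis
    by (simp add: pd_x_def z monom_xs_upd C_def DERIV_imp_deriv)
qed

text \<open>The factor \<open>snd z\<close> makes each monomial an eigenfunction, so no exponent has
  to be lowered; the derivative enters the integration by parts in \<open>r\<close> in just this
  combination.\<close>

lemma pd_t_monom_xs: "snd z * pd_t (monom_xs \<alpha> k) z = real k * monom_xs \<alpha> k z"
proof -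
  obtain x t where z: "z = (x, t)" by (cases z)
  have "((\<lambda>s. (\<Prod>i\<in>UNIV. (x $ i) ^ \<alpha> i) * s ^ k) has_real_derivative
      (\<Prod>i\<in>UNIV. (x $ i) ^ \<alpha> i) * (real k * t ^ (k - 1))) (at t)"
    by (auto intro!: derivative_eq_intros)
  then show ?thesis
    by (cases k) (simp_all add: pd_t_def z monom_xs_def DERIV_imp_deriv)
qed

lemma monom_xs_differentiable: "monom_xs \<alpha> k differentiable (at z)"
  using wpoly_differentiable[OF wpoly_monom_xs[of 1]] by simp

lemma partials_cmult:
  assumes "f differentiable (at z)"
  shows "pd_x i (\<lambda>z. c * f z) z = c * pd_x i f z" "pd_t (\<lambda>z. c * f z) z = c * pd_t f z"
  using partials_mult[OF differentiable_const assms] by (simp_all add: partials_const)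

text \<open>
  The next two lemmas are integration by parts in \<open>x\<^sub>i\<close> and in \<open>r\<close>; on monomials they amount to
  the recurrences of the Gaussian moments and of the Gamma function.
\<close>

lemma hyp_integral_x_divergence:
  fixes f :: "(real ^ 'd::finite) \<times> real \<Rightarrow> real"
  assumes \<rho>: "0 < \<rho>" and \<mu>: "- (1/2) < \<mu>" and f: "wpoly w d f"
  shows "has_bochner_integral lborel
    (hyp_weighted \<rho> \<mu> (\<lambda>z. pd_x i f z - 2 * (fst z $ i * f z))) 0"
proof -
  \<comment> \<open>Differentiability is carried along because the induction rule does not say that
    the two summands are polynomials, while the sum rule for partial derivatives needs it.\<close>
  have "(\<forall>z. f differentiable (at z)) \<and> has_bochner_integral lborel
    (hyp_weighted \<rho> \<mu> (\<lambda>z. pd_x i f z - 2 * (fst z $ i * f z))) 0"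
    using f
  proof (induction rule: wpoly_monom_induct)
    case (monom c \<alpha> k)
    have L: "has_bochner_integral lborel (hyp_weighted \<rho> \<mu> (monom_xs (\<alpha>(i := m)) k))
        (gauss_moment m * (exp (- \<rho>\<^sup>2) * (\<Prod>j\<in>UNIV - {i}. gauss_moment (\<alpha> j))
          * Gamma (real k + \<mu> + 1/2)))" for m
    proof -
      have "(\<Prod>j\<in>UNIV. gauss_moment ((\<alpha>(i := m)) j))
          = gauss_moment m * (\<Prod>j\<in>UNIV - {i}. gauss_moment (\<alpha> j))"
        by (subst prod.remove[of UNIV i]) (auto intro!: prod.cong)
      then show ?thesis using hyp_weighted_monom[OF \<rho> \<mu>, of "\<alpha>(i := m)" k] by (simp add: mult_ac)
    qed
    \<comment> \<open>The moment recurrence covers positive \<open>\<alpha> i\<close>; for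
      \<open>\<alpha> i = 0\<close> the claim is that the first moment vanishes.\<close>
    have "real (\<alpha> i) * gauss_moment (\<alpha> i - 1) - 2 * gauss_moment (Suc (\<alpha> i)) = 0"
      using gauss_moment_rec[of "\<alpha> i - 1"] by (cases "\<alpha> i") (auto simp: gauss_moment_1)
    then have "c * (real (\<alpha> i) * (gauss_moment (\<alpha> i - 1) * C) - 2 * (gauss_moment (Suc (\<alpha> i)) * C)) = 0" for C
      by (simp add: mult.assoc[symmetric] left_diff_distrib[symmetric])
    then have "has_bochner_integral lborel (hyp_weighted \<rho> \<mu> (\<lambda>z. c *
        (real (\<alpha> i) * monom_xs (\<alpha>(i := \<alpha> i - 1)) k z - 2 * monom_xs (\<alpha>(i := Suc (\<alpha> i))) k z))) 0"
      unfolding hyp_weighted_cmult hyp_weighted_diff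
      using has_bochner_integral_mult_right[OF has_bochner_integral_diff[OF
        has_bochner_integral_mult_right[OF L[of "\<alpha> i - 1"], of "real (\<alpha> i)"]
        has_bochner_integral_mult_right[OF L[of "Suc (\<alpha> i)"], of 2]], of c]
      by (simp only:)
    moreover have "(\<lambda>z. pd_x i (\<lambda>z. c * monom_xs \<alpha> k z) z - 2 * (fst z $ i * (c * monom_xs \<alpha> k z)))
      = (\<lambda>z. c * (real (\<alpha> i) * monom_xs (\<alpha>(i := \<alpha> i - 1)) k z - 2 * monom_xs (\<alpha>(i := Suc (\<alpha> i))) k z))"
      by (rule ext) (simp add: partials_cmult monom_xs_differentiable pd_x_monom_xs
          flip: coord_times_monom_xs, simp add: algebra_simps)
    ultimately show ?case
      using monom_xs_differentiable[of \<alpha> k] by (simp add: differentiable_mult del: split_paired_All)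
  next
    case (add f g)
    from add have df: "\<And>z. f differentiable (at z)" "\<And>z. g differentiable (at z)" by blast+
    have "(\<lambda>z. pd_x i (\<lambda>z. f z + g z) z - 2 * (fst z $ i * (f z + g z)))
      = (\<lambda>z. (pd_x i f z - 2 * (fst z $ i * f z)) + (pd_x i g z - 2 * (fst z $ i * g z)))"
      by (rule ext) (simp add: partials_add df algebra_simps add_divide_distrib)
    note eq = this
    show ?case
      unfolding eq hyp_weighted_add[of _ _ "\<lambda>z. pd_x i f z - 2 * (fst z $ i * f z)"]
      using add df has_bochner_integral_add[OF conjunct2[OF add(1)] conjunct2[OF add(2)]]
      by (simp del: split_paired_All)
  qed
  then show ?thesis ..
qed

lemma hyp_integral_r_divergence:
  fixes f :: "(real ^ 'd::finite) \<times> real \<Rightarrow> real"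
  assumes \<rho>: "0 < \<rho>" and \<mu>: "- (1/2) < \<mu>" and f: "wpoly w d f"
  shows "has_bochner_integral lborel
    (hyp_weighted \<rho> \<mu> (\<lambda>z. snd z * pd_t f z + (\<mu> + 1/2 - snd z) * f z)) 0"
proof -
  have "(\<forall>z. f differentiable (at z)) \<and> has_bochner_integral lborel
    (hyp_weighted \<rho> \<mu> (\<lambda>z. snd z * pd_t f z + (\<mu> + 1/2 - snd z) * f z)) 0"
    using f
  proof (induction rule: wpoly_monom_induct)
    case (monom c \<alpha> k)
    let ?b = "real k + \<mu> + 1/2"
    \<comment> \<open>The functional equation of Gamma; \<open>?b\<close> is positive and thus not a
      pole.\<close>
    have "Gamma (real (Suc k) + \<mu> + 1/2) = ?b * Gamma ?b"
      using Gamma_plus1[of ?b] \<mu> by (auto simp: nonpos_Ints_def add_ac)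
    then have "c * (?b * (C * Gamma ?b) - C * Gamma (real (Suc k) + \<mu> + 1/2)) = 0" for C
      by simp
    then have "has_bochner_integral lborel (hyp_weighted \<rho> \<mu> (\<lambda>z. c *
        (?b * monom_xs \<alpha> k z - monom_xs \<alpha> (Suc k) z))) 0"
      unfolding hyp_weighted_cmult hyp_weighted_diff
      using has_bochner_integral_mult_right[OF has_bochner_integral_diff[OF
        has_bochner_integral_mult_right[OF hyp_weighted_monom[OF \<rho> \<mu>, of \<alpha> k], of ?b]
        hyp_weighted_monom[OF \<rho> \<mu>, of \<alpha> "Suc k"]], of c]
      by (simp only:)
    moreover have "(\<lambda>z. snd z * pd_t (\<lambda>z. c * monom_xs \<alpha> k z) z + (\<mu> + 1/2 - snd z) * (c * monom_xs \<alpha> k z))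
      = (\<lambda>z. c * (?b * monom_xs \<alpha> k z - monom_xs \<alpha> (Suc k) z))"
    proof (rule ext)
      fix z :: "(real ^ 'd) \<times> real"
      have "snd z * pd_t (\<lambda>z. c * monom_xs \<alpha> k z) z = c * (real k * monom_xs \<alpha> k z)"
        using pd_t_monom_xs[of z \<alpha> k] by (simp add: partials_cmult monom_xs_differentiable mult.left_commute)
      then show "snd z * pd_t (\<lambda>z. c * monom_xs \<alpha> k z) z + (\<mu> + 1/2 - snd z) * (c * monom_xs \<alpha> k z)
        = c * (?b * monom_xs \<alpha> k z - monom_xs \<alpha> (Suc k) z)"
        by (simp add: last_times_monom_xs[symmetric] algebra_simps)
    qed
    ultimately show ?case
      using monom_xs_differentiable[of \<alpha> k] by (simp add: differentiable_mult del: split_paired_All)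
  next
    case (add f g)
    from add have df: "\<And>z. f differentiable (at z)" "\<And>z. g differentiable (at z)" by blast+
    have "(\<lambda>z. snd z * pd_t (\<lambda>z. f z + g z) z + (\<mu> + 1/2 - snd z) * (f z + g z))
      = (\<lambda>z. (snd z * pd_t f z + (\<mu> + 1/2 - snd z) * f z) + (snd z * pd_t g z + (\<mu> + 1/2 - snd z) * g z))"
      by (rule ext) (simp add: partials_add df algebra_simps add_divide_distrib)
    note eq = this
    show ?case
      unfolding eq hyp_weighted_add[of _ _ "\<lambda>z. snd z * pd_t f z + (\<mu> + 1/2 - snd z) * f z"]
      using add df has_bochner_integral_add[OF conjunct2[OF add(1)] conjunct2[OF add(2)]]
      by (simp del: split_paired_All)
  qed
  then show ?thesis ..
qed

section \<open>The Hermite-Laguerre operator\<close>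

text \<open>The first two terms form the Hermite operator; the bracket is the Laguerre operator with
  parameter \<open>\<mu> - 1/2\<close>. The factor 4 matches the eigenvalues: degree
  \<open>j\<close> in \<open>x\<close> and \<open>k\<close> in \<open>r\<close> give
  \<open>- 2 * j - 4 * k\<close>, which is -2 times the weighted degree.\<close>

definition herm_lag :: "real \<Rightarrow> ((real ^ 'd::finite) \<times> real \<Rightarrow> real) \<Rightarrow> (real ^ 'd) \<times> real \<Rightarrow> real" where
  "herm_lag \<mu> f z = laplace_x f z - 2 * euler_x f z
     + 4 * (snd z * pd_t (pd_t f) z + (\<mu> + 1/2 - snd z) * pd_t f z)"

text \<open>The difference is a weighted divergence, so it integrates to 0 by the two integrations
  by parts.\<close>

lemma herm_lag_symmetric:
  fixes f g :: "(real ^ 'd::finite) \<times> real \<Rightarrow> real"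
  assumes \<rho>: "0 < \<rho>" and \<mu>: "- (1/2) < \<mu>" and f: "wpoly 2 d f" and g: "wpoly 2 e g"
  shows "has_bochner_integral lborel
    (hyp_weighted \<rho> \<mu> (\<lambda>z. g z * herm_lag \<mu> f z - f z * herm_lag \<mu> g z)) 0"
proof -
  \<comment> \<open>The Wronskians of \<open>f\<close> and \<open>g\<close> in each variable. On
    differentiating them the products of first derivatives cancel, leaving only second
    derivatives.\<close>
  define h where "h i z = g z * pd_x i f z - f z * pd_x i g z" for i z
  define h0 where "h0 z = g z * pd_t f z - f z * pd_t g z" for z
  have h: "wpoly 2 (d + e) (h i)" for i
    unfolding h_def by (intro wpoly_diff wpoly_mono[OF wpoly_mult[OF g _ wpoly_partials(1)[OF f]]]
      wpoly_mono[OF wpoly_mult[OF f _ wpoly_partials(1)[OF g]]]) auto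
  have h0: "wpoly 2 (d + e) h0"
    unfolding h0_def[abs_def] by (intro wpoly_diff wpoly_mono[OF wpoly_mult[OF g _ wpoly_partials(2)[OF f]]]
      wpoly_mono[OF wpoly_mult[OF f _ wpoly_partials(2)[OF g]]]) auto
  note df = wpoly_differentiable[OF f] wpoly_differentiable[OF g]
    wpoly_differentiable[OF wpoly_partials(1)[OF f]] wpoly_differentiable[OF wpoly_partials(1)[OF g]]
    wpoly_differentiable[OF wpoly_partials(2)[OF f]] wpoly_differentiable[OF wpoly_partials(2)[OF g]]
  have x: "pd_x i (h i) z = g z * pd_x i (pd_x i f) z - f z * pd_x i (pd_x i g) z" for i z
    unfolding h_def[abs_def] by (simp add: partials_diff partials_mult df differentiable_mult)
  have t: "pd_t h0 z = g z * pd_t (pd_t f) z - f z * pd_t (pd_t g) z" for z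
    unfolding h0_def[abs_def] by (simp add: partials_diff partials_mult df differentiable_mult)
  have "(\<lambda>z. g z * herm_lag \<mu> f z - f z * herm_lag \<mu> g z)
    = (\<lambda>z. (\<Sum>i\<in>UNIV. pd_x i (h i) z - 2 * (fst z $ i * h i z))
        + 4 * (snd z * pd_t h0 z + (\<mu> + 1/2 - snd z) * h0 z))"
    unfolding x t
    by (rule ext) (simp add: h_def h0_def herm_lag_def laplace_x_def euler_x_def algebra_simps
        sum_distrib_left sum_subtractf sum.distrib)
  moreover have "has_bochner_integral lborel (hyp_weighted \<rho> \<mu>
      (\<lambda>z. (\<Sum>i\<in>UNIV. pd_x i (h i) z - 2 * (fst z $ i * h i z))
        + 4 * (snd z * pd_t h0 z + (\<mu> + 1/2 - snd z) * h0 z))) ((\<Sum>i\<in>(UNIV :: 'd set). 0) + 4 * 0)"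
    unfolding hyp_weighted_add[of _ _ "\<lambda>z. (\<Sum>i\<in>UNIV. pd_x i (h i) z - 2 * (fst z $ i * h i z))"]
      hyp_weighted_sum hyp_weighted_cmult[of _ _ 4]
    by (intro has_bochner_integral_add has_bochner_integral_sum has_bochner_integral_mult_right
        hyp_integral_x_divergence[OF \<rho> \<mu> h] hyp_integral_r_divergence[OF \<rho> \<mu> h0])
  ultimately show ?thesis by simp
qed

text \<open>Euler: the top-degree part is an eigenfunction of the weighted Euler operator.\<close>

lemma weighted_euler:
  assumes "wpoly 2 d f"
  shows "wpoly 2 (d - 1) (\<lambda>z. euler_x f z + 2 * (snd z * pd_t f z) - of_int d * f z)"
  using assms
proof (induction rule: wpoly.induct)
  case (zero d)
  show ?case by (simp add: euler_x_def partials_const wpoly.zero)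
next
  case (const d c)
  \<comment> \<open>What remains is the constant \<open>- d * c\<close>. It is 0 for
    \<open>d = 0\<close>, and otherwise degree \<open>d - 1\<close> still admits constants.\<close>
  show ?case
  proof (cases "d = 0")
    case True
    then show ?thesis by (simp add: euler_x_def partials_const wpoly.zero)
  next
    case False
    with const have "0 \<le> d - 1" by simp
    from wpoly.const[OF this, of 2 "- of_int d * c"] show ?thesis
      by (simp add: euler_x_def partials_const)
  qed
next
  case (coord d f j)
  note df = wpoly_differentiable[OF coord(1)]
  have "(\<lambda>z. euler_x (\<lambda>z. fst z $ j * f z) z + 2 * (snd z * pd_t (\<lambda>z. fst z $ j * f z) z)
      - of_int (d + 1) * (fst z $ j * f z))
    = (\<lambda>z. fst z $ j * (euler_x f z + 2 * (snd z * pd_t f z) - of_int d * f z))"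
  proof (rule ext)
    fix z
    have "euler_x (\<lambda>z. fst z $ j * f z) z
      = (\<Sum>i\<in>UNIV. fst z $ j * (fst z $ i * pd_x i f z) + (if i = j then fst z $ j * f z else 0))"
      unfolding euler_x_def using df
      by (intro sum.cong refl) (simp add: partials_mult differentiable_fst_nth partials_fst algebra_simps)
    also have "\<dots> = fst z $ j * euler_x f z + fst z $ j * f z"
      by (simp add: sum.distrib sum_distrib_left euler_x_def)
    finally show "euler_x (\<lambda>z. fst z $ j * f z) z + 2 * (snd z * pd_t (\<lambda>z. fst z $ j * f z) z)
        - of_int (d + 1) * (fst z $ j * f z)
      = fst z $ j * (euler_x f z + 2 * (snd z * pd_t f z) - of_int d * f z)"
      using df by (simp add: partials_mult differentiable_fst_nth partials_fst algebra_simps)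
  qed
  then show ?case using coord wpoly_coordI[of 2 "d + 1 - 1"] by simp
next
  case (last d f)
  note df = wpoly_differentiable[OF last(1)]
  have "(\<lambda>z. euler_x (\<lambda>z. snd z * f z) z + 2 * (snd z * pd_t (\<lambda>z. snd z * f z) z)
      - of_int (d + 2) * (snd z * f z))
    = (\<lambda>z. snd z * (euler_x f z + 2 * (snd z * pd_t f z) - of_int d * f z))"
    using df
    by (intro ext) (simp add: euler_x_def partials_mult differentiable_snd_proj partials_snd
        algebra_simps sum_distrib_left)
  then show ?case using last wpoly_lastI[of 2 "d + 2 - 1"] by simp
next
  case (add d f g)
  have "(\<lambda>z. euler_x (\<lambda>z. f z + g z) z + 2 * (snd z * pd_t (\<lambda>z. f z + g z) z) - of_int d * (f z + g z))
    = (\<lambda>z. (euler_x f z + 2 * (snd z * pd_t f z) - of_int d * f z)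
         + (euler_x g z + 2 * (snd z * pd_t g z) - of_int d * g z))"
    using add(1,2)[THEN wpoly_differentiable]
    by (intro ext) (simp add: euler_x_def partials_add algebra_simps sum.distrib)
  then show ?case using wpoly.add[OF add.IH] by simp
qed

text \<open>The Laplacian, \<open>r \<partial>\<^sub>r\<^sup>2\<close> and
  \<open>\<partial>\<^sub>r\<close> each lower the weighted degree by 2. The other terms are -2
  times the weighted Euler operator, whose top-degree part is cancelled by
  \<open>2 * d * f\<close>.\<close>

lemma herm_lag_degree:
  assumes f: "wpoly 2 d f"
  shows "wpoly 2 (d - 1) (\<lambda>z. herm_lag \<mu> f z + 2 * of_int d * f z)"
proof -
  have "wpoly 2 (d - 1) (laplace_x f)"
    unfolding laplace_x_def[abs_def]
    by (intro wpoly_sum wpoly_mono[OF wpoly_partials(1)[OF wpoly_partials(1)[OF f]]]) simp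
  moreover have "wpoly 2 (d - 2) (\<lambda>z. snd z * pd_t (pd_t f) z)"
    by (intro wpoly_lastI wpoly_partials f)
  then have "wpoly 2 (d - 1) (\<lambda>z. 4 * (snd z * pd_t (pd_t f) z))"
    by (intro wpoly_cmult) (auto intro: wpoly_mono)
  moreover have "wpoly 2 (d - 1) (\<lambda>z. 4 * (\<mu> + 1/2) * pd_t f z)"
    using wpoly_partials(2)[OF f] by (intro wpoly_cmult) (auto intro: wpoly_mono)
  moreover note wpoly_cmult[OF weighted_euler[OF f], of "-2"]
  ultimately have "wpoly 2 (d - 1) (\<lambda>z. laplace_x f z + 4 * (snd z * pd_t (pd_t f) z)
      + 4 * (\<mu> + 1/2) * pd_t f z + -2 * (euler_x f z + 2 * (snd z * pd_t f z) - of_int d * f z))"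
    by (intro wpoly.add)
  then show ?thesis by (simp add: herm_lag_def algebra_simps)
qed

section \<open>Back to the hyperboloid\<close>

text \<open>\<open>r\<close> is quadratic in \<open>(x, t)\<close>, which is why it carries weight
  2: weighted degree turns into ordinary degree. Lower-degree test polynomials in
  \<open>(x, r)\<close> are thus admissible in the orthogonality condition.\<close>

lemma wpoly_hyp_coords:
  "wpoly 2 d f \<Longrightarrow> wpoly 1 d (\<lambda>z. f (hyp_coords \<rho> z))"
proof (induction rule: wpoly.induct)
  case (coord d f i)
  then show ?case using wpoly.coord[of 1 d "\<lambda>z. f (hyp_coords \<rho> z)" i] by (simp add: hyp_coords_def)
next
  case (last d f)
  have "wpoly 1 2 (\<lambda>z :: (real ^ 'a) \<times> real. snd (hyp_coords \<rho> z))"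
    using wpoly_power[OF wpoly_snd, of 1 2]
    by (auto simp: hyp_coords_def intro!: wpoly_diff wpoly_norm_power2 wpoly.const)
  from wpoly_mult[OF this _ last.IH] show ?case by (simp add: add.commute)
qed (auto intro: wpoly.intros)

text \<open>Evenness leaves only powers of
  \<open>t\<^sup>2 = r + \<rho>\<^sup>2 + (norm x)\<^sup>2\<close>, and the right side has weighted
  degree 2.\<close>

lemma even_poly_hyp_coords:
  assumes u: "u \<in> polys n" and even: "\<And>x t. u (x, - t) = u (x, t)"
  obtains P where "wpoly 2 (int n) P" "u = (\<lambda>z. P (hyp_coords \<rho> z))"
proof -
  from u have "wpoly 1 (int n) u" by (simp add: polys_iff_wpoly)
  from wpoly_monom_expansion[OF this] obtain A c where A: "finite A" "\<forall>a\<in>A. wdeg 1 a \<le> int n"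
    "\<forall>z. u z = (\<Sum>a\<in>A. c a * monom_xs (fst a) (snd a) z)"
    by (elim exE conjE)
  \<comment> \<open>The monomial with \<open>t ^ k\<close> rewritten through \<open>r\<close>. For
    odd \<open>k\<close> its value is arbitrary, as the coefficient in \<open>P\<close> is then
    0.\<close>
  define m where "m a z = (\<Prod>i\<in>UNIV. (fst z $ i) ^ fst a i)
      * (snd z + \<rho>\<^sup>2 + (norm (fst z))\<^sup>2) ^ (snd a div 2)"
    for a :: "('a \<Rightarrow> nat) \<times> nat" and z :: "(real ^ 'a) \<times> real"
  define P where "P z = (\<Sum>a\<in>A. (if even (snd a) then c a else 0) * m a z)" for z
  have "wpoly 2 (int n) P"
    unfolding P_def[abs_def]
  proof (intro wpoly_sum wpoly_cmult)
    fix a assume "a \<in> A"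
    with A(2) have "wdeg 1 a \<le> int n" by blast
    moreover have "int (snd a div 2) * 2 \<le> int (snd a)" by linarith
    ultimately have le: "(\<Sum>i\<in>UNIV. int (fst a i) * 1) + int (snd a div 2) * 2 \<le> int n"
      by (simp add: wdeg_def)
    have "wpoly 2 2 (\<lambda>z :: (real ^ 'a) \<times> real. snd z + \<rho>\<^sup>2 + (norm (fst z))\<^sup>2)"
      by (intro wpoly.add wpoly_snd wpoly.const wpoly_norm_power2) auto
    then have "wpoly 2 ((\<Sum>i\<in>UNIV. int (fst a i) * 1) + int (snd a div 2) * 2) (m a)"
      unfolding m_def[abs_def] by (intro wpoly_mult wpoly_prod wpoly_power wpoly_fst) auto
    then show "wpoly 2 (int n) (m a)" using le by (rule wpoly_mono)
  qed
  moreover have "u = (\<lambda>z. P (hyp_coords \<rho> z))"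
  proof (rule ext)
    fix z :: "(real ^ 'a) \<times> real"
    obtain x t where z: "z = (x, t)" by (cases z)
    \<comment> \<open>Averaging over \<open>t\<close> and \<open>- t\<close> removes the odd powers
      term by term, even if the coefficients \<open>c\<close> themselves are nonzero there.\<close>
    have "u z = (u (x, t) + u (x, - t)) / 2" by (simp add: even z)
    also have "\<dots> = (\<Sum>a\<in>A. c a * ((monom_xs (fst a) (snd a) (x, t) + monom_xs (fst a) (snd a) (x, - t)) / 2))"
      unfolding A(3)[rule_format] by (simp add: sum.distrib[symmetric] sum_divide_distrib algebra_simps add_divide_distrib)
    also have "\<dots> = P (hyp_coords \<rho> z)"
      unfolding P_def
    proof (rule sum.cong[OF refl])
      fix a
      show "c a * ((monom_xs (fst a) (snd a) (x, t) + monom_xs (fst a) (snd a) (x, - t)) / 2)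
        = (if even (snd a) then c a else 0) * m a (hyp_coords \<rho> z)"
        by (cases "even (snd a)") (auto simp: monom_xs_def m_def hyp_coords_def z simp flip: power_mult)
    qed
    finally show "u z = P (hyp_coords \<rho> z)" .
  qed
  ultimately show ?thesis by (rule that)
qed

section \<open>Definiteness of the inner product on polynomials in \<open>(x, r)\<close>\<close>

lemma wpoly_section: "wpoly w d f \<Longrightarrow> \<exists>p. \<forall>s. f (x, s) = poly p s"
proof (induction rule: wpoly.induct)
  case (zero d)
  show ?case by (rule exI[of _ 0]) simp
next
  case (const d c)
  show ?case by (rule exI[of _ "[:c:]"]) simp
next
  case (coord d f i)
  then obtain p where "\<forall>s. f (x, s) = poly p s" by blast
  then show ?case by (intro exI[of _ "smult (x $ i) p"]) simp
next
  case (last d f)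
  then obtain p where "\<forall>s. f (x, s) = poly p s" by blast
  then show ?case by (intro exI[of _ "pCons 0 p"]) simp
next
  case (add d f g)
  then obtain p q where "\<forall>s. f (x, s) = poly p s" "\<forall>s. g (x, s) = poly q s" by blast
  then show ?case by (intro exI[of _ "p + q"]) simp
qed

text \<open>A nonnegative function with integral 0 vanishes almost everywhere, hence, by continuity,
  \<open>f\<close> vanishes wherever \<open>r > 0\<close>. As a polynomial in \<open>r\<close> for
  fixed \<open>x\<close>, it then vanishes for all \<open>r\<close>.\<close>

lemma hyp_norm_eq_0:
  fixes f :: "(real ^ 'd::finite) \<times> real \<Rightarrow> real"
  assumes \<rho>: "0 < \<rho>" and \<mu>: "- (1/2) < \<mu>" and f: "wpoly 2 d f"
    and 0: "integral\<^sup>L lborel (hyp_weighted \<rho> \<mu> (\<lambda>z. f z * f z)) = 0"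
  shows "f z = 0"
proof -
  have "integrable lborel (hyp_weighted \<rho> \<mu> (\<lambda>z. f z * f z))"
    using wpoly_mult[OF f _ f] by (intro integrable_hyp_weighted[OF \<rho> \<mu>]) auto
  moreover have "0 \<le> hyp_weighted \<rho> \<mu> (\<lambda>z. f z * f z) z" for z
    by (auto simp: hyp_weighted_def W_half_def case_prod_unfold)
  ultimately have ae: "AE z in lborel. hyp_weighted \<rho> \<mu> (\<lambda>z. f z * f z) z = 0"
    using 0 by (subst (asm) integral_nonneg_eq_0_iff_AE) auto
  \<comment> \<open>The strict inequality keeps to the points where the weight is positive;
    \<open>U\<close> is open, so it is empty once it is a null set.\<close>
  define U where "U = {z :: (real ^ 'd) \<times> real. \<rho>\<^sup>2 + (norm (fst z))\<^sup>2 < (snd z)\<^sup>2} \<inter> {z. f (hyp_coords \<rho> z) \<noteq> 0}"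
  have "continuous_on UNIV (\<lambda>z. f (hyp_coords \<rho> z))"
    using wpoly_differentiable[OF wpoly_hyp_coords[OF f]]
    by (auto intro!: differentiable_imp_continuous_on simp: differentiable_on_def)
  then have "open U"
    unfolding U_def
    by (intro open_Int open_Collect_less open_Collect_neq continuous_intros)
  have pos: "hyp_weighted \<rho> \<mu> (\<lambda>z. f z * f z) z \<noteq> 0" if "z \<in> U" for z
  proof -
    obtain x t where z: "z = (x, t)" by (cases z)
    have *: "\<rho>\<^sup>2 + (norm x)\<^sup>2 < t\<^sup>2" "f (hyp_coords \<rho> (x, t)) \<noteq> 0" using that by (auto simp: U_def z)
    moreover have "t \<noteq> 0" using *(1) by (metis not_sum_power2_lt_zero zero_power2)
    ultimately show ?thesis
      using \<rho> by (auto simp: z hyp_weighted_def W_half_def hyperboloid_iff)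
  qed
  have "AE z in lborel. z \<notin> U" using ae by eventually_elim (use pos in blast)
  then have "U \<in> null_sets lborel"
    using \<open>open U\<close> by (subst (asm) AE_iff_null_sets[symmetric]) auto
  then have "negligible U"
    unfolding negligible_iff_null_sets by (rule null_sets_completionI)
  then have "U = {}" using \<open>open U\<close> open_not_negligible by blast
  obtain x s where z: "z = (x, s)" by (cases z)
  have van: "f (x, r) = 0" if "0 < r" for r
  proof -
    \<comment> \<open>A preimage of \<open>(x, r)\<close> under \<open>hyp_coords\<close>, inside
      the hyperboloid since \<open>r > 0\<close>.\<close>
    define t where "t = sqrt (r + \<rho>\<^sup>2 + (norm x)\<^sup>2)"
    have "t\<^sup>2 = r + \<rho>\<^sup>2 + (norm x)\<^sup>2" using that by (simp add: t_def)
    then have "\<rho>\<^sup>2 + (norm x)\<^sup>2 < t\<^sup>2" "hyp_coords \<rho> (x, t) = (x, r)"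
      using that by (simp_all add: hyp_coords_def)
    then show ?thesis using equals0D[OF \<open>U = {}\<close>, of "(x, t)"] by (simp add: U_def)
  qed
  obtain p where p: "\<forall>s. f (x, s) = poly p s" using wpoly_section[OF f] by blast
  have "p = 0"
  proof (rule ccontr)
    assume "p \<noteq> 0"
    then have "finite {r. poly p r = 0}" by (rule poly_roots_finite)
    moreover have "{0<..} \<subseteq> {r. poly p r = 0}" using van p by auto
    ultimately show False using infinite_Ioi[of "0 :: real"] finite_subset by blast
  qed
  then show ?thesis using p z by simp
qed

section \<open>Transformation of the differential operator\<close>

lemma partials_hyp_coords:
  assumes f: "wpoly 2 d f"
  shows "pd_x i (\<lambda>z. f (hyp_coords \<rho> z)) z
      = pd_x i f (hyp_coords \<rho> z) - 2 * (fst z $ i * pd_t f (hyp_coords \<rho> z))"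
    and "pd_t (\<lambda>z. f (hyp_coords \<rho> z)) z = 2 * snd z * pd_t f (hyp_coords \<rho> z)"
proof -
  have "(hyp_coords \<rho> has_derivative
      (\<lambda>h. (fst h, 2 * snd z * snd h - 2 * inner (fst z) (fst h)))) (at z)"
    unfolding hyp_coords_def[abs_def] power2_norm_eq_inner
    by (auto intro!: derivative_eq_intros simp: inner_commute)
  from has_derivative_compose[OF this has_derivative_partials[OF wpoly_differentiable[OF f]]]
  have D: "((\<lambda>z. f (hyp_coords \<rho> z)) has_derivative
      (\<lambda>h. (\<Sum>j\<in>UNIV. fst h $ j * pd_x j f (hyp_coords \<rho> z))
        + (2 * snd z * snd h - 2 * inner (fst z) (fst h)) * pd_t f (hyp_coords \<rho> z))) (at z)"
    by simp
  have "(\<Sum>j\<in>UNIV. axis i 1 $ j * pd_x j f (hyp_coords \<rho> z)) = pd_x i f (hyp_coords \<rho> z)"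
    by (simp add: axis_def if_distrib[of "\<lambda>c. c * _"] cong: if_cong)
  then show "pd_x i (\<lambda>z. f (hyp_coords \<rho> z)) z
      = pd_x i f (hyp_coords \<rho> z) - 2 * (fst z $ i * pd_t f (hyp_coords \<rho> z))"
    unfolding partials_has_derivative(1)[OF D] by (simp add: inner_axis)
  show "pd_t (\<lambda>z. f (hyp_coords \<rho> z)) z = 2 * snd z * pd_t f (hyp_coords \<rho> z)"
    unfolding partials_has_derivative(2)[OF D] by simp
qed

text \<open>By the chain rule \<open>\<partial>\<^sub>t u = 2 t \<partial>\<^sub>r P\<close>, so the
  single factors \<open>1 / t\<close> disappear, and the remaining \<open>t\<^sup>2\<close> is
  expressed by \<open>r\<close>.\<close>

lemma hyp_operator_hyp_coords:
  fixes P :: "(real ^ 'd::finite) \<times> real \<Rightarrow> real"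
  assumes P: "wpoly 2 d P" and t: "t \<noteq> 0" and u: "u = (\<lambda>z. P (hyp_coords \<rho> z))"
  shows "(1 - \<rho>\<^sup>2 / t\<^sup>2) * pd_t (pd_t u) (x, t)
       + laplace_x u (x, t)
       + (2 / t) * euler_x (pd_t u) (x, t)
       - (2 / t) * (t\<^sup>2 - \<rho>\<^sup>2) * pd_t u (x, t)
       - 2 * euler_x u (x, t)
       + (1 / t) * (\<rho>\<^sup>2 / t\<^sup>2 + 2 * \<mu> + real CARD('d)) * pd_t u (x, t)
       = herm_lag \<mu> P (hyp_coords \<rho> (x, t))"
proof -
  define y where "y = hyp_coords \<rho> (x, t)"
  define R where "R = pd_t P"
  have R: "wpoly 2 (d - 2) R" unfolding R_def by (rule wpoly_partials(2)[OF P])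
  note Rc = wpoly_differentiable[OF wpoly_hyp_coords[OF R]]
  \<comment> \<open>\<open>F i\<close> is the derivative of \<open>u\<close> in
    \<open>x $ i\<close>, written in the new coordinates; it is differentiated once more for the
    Laplacian.\<close>
  define F where "F i z = pd_x i P z - 2 * (fst z $ i * R z)" for i z
  have F: "wpoly 2 d (F i)" for i
  proof -
    have "wpoly 2 d (\<lambda>z. fst z $ i * R z)" using R by (intro wpoly_coordI) (auto intro: wpoly_mono)
    then show ?thesis unfolding F_def[abs_def]
      by (intro wpoly_diff wpoly_cmult wpoly_mono[OF wpoly_partials(1)[OF P]]) auto
  qed
  have ut: "pd_t u = (\<lambda>z. 2 * snd z * R (hyp_coords \<rho> z))"
    unfolding u R_def by (rule ext) (rule partials_hyp_coords(2)[OF P])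
  have ux: "pd_x i u = (\<lambda>z. F i (hyp_coords \<rho> z))" for i
  proof (rule ext)
    fix z :: "(real ^ 'd) \<times> real"
    have "fst (hyp_coords \<rho> z) = fst z" by (simp add: hyp_coords_def)
    then show "pd_x i u z = F i (hyp_coords \<rho> z)"
      unfolding u F_def R_def partials_hyp_coords(1)[OF P] by simp
  qed
  have sn: "(\<lambda>z :: (real ^ 'd) \<times> real. 2 * snd z) differentiable (at z)" for z
    by (intro differentiable_mult differentiable_snd_proj differentiable_const)
  have utt: "pd_t (pd_t u) (x, t) = 2 * R y + 4 * t\<^sup>2 * pd_t R y"
    unfolding ut y_def
    by (simp add: partials_mult[OF sn Rc] partials_cmult differentiable_snd_proj partials_snd
        partials_hyp_coords[OF R] power2_eq_square)
  have utx: "pd_x i (pd_t u) (x, t) = 2 * t * (pd_x i R y - 2 * (x $ i * pd_t R y))" for i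
    unfolding ut y_def
    by (simp add: partials_mult[OF sn Rc] partials_cmult differentiable_snd_proj partials_snd
        partials_hyp_coords[OF R])
  note dP = wpoly_differentiable[OF wpoly_partials(1)[OF P]] wpoly_differentiable[OF R]
  have Fx: "pd_x i (F i) y = pd_x i (pd_x i P) y - 2 * (x $ i * pd_x i R y + R y)"
    and Ft: "pd_t (F i) y = pd_x i R y - 2 * (x $ i * pd_t R y)" for i
    unfolding F_def[abs_def]
    by (simp_all add: partials_diff partials_cmult partials_mult dP differentiable_mult
        differentiable_fst_nth partials_fst partials_commute[OF P, folded R_def] y_def hyp_coords_def)
  have uxx: "pd_x i (pd_x i u) (x, t)
      = pd_x i (pd_x i P) y - 2 * R y - 4 * (x $ i * pd_x i R y) + 4 * pd_t R y * (x $ i)\<^sup>2" for i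
    unfolding ux partials_hyp_coords(1)[OF F] y_def[symmetric] Fx Ft
    by (simp add: algebra_simps power2_eq_square)
  have fy: "fst y = x" "snd y = t\<^sup>2 - \<rho>\<^sup>2 - (norm x)\<^sup>2" by (simp_all add: y_def hyp_coords_def)
  have lap: "laplace_x u (x, t) = laplace_x P y - 2 * real CARD('d) * R y - 4 * euler_x R y
      + 4 * pd_t R y * (norm x)\<^sup>2"
    unfolding laplace_x_def uxx euler_x_def norm_vec_power2
    by (simp add: sum.distrib sum_subtractf sum_distrib_left fy)
  have et: "euler_x (pd_t u) (x, t) = 2 * t * (euler_x R y - 2 * pd_t R y * (norm x)\<^sup>2)"
    unfolding euler_x_def utx norm_vec_power2
    by (simp add: sum_distrib_left sum_subtractf[symmetric] fy algebra_simps power2_eq_square)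
  have eu: "euler_x u (x, t) = euler_x P y - 2 * R y * (norm x)\<^sup>2"
    unfolding euler_x_def ux norm_vec_power2
    by (simp add: F_def sum_distrib_left sum_subtractf[symmetric] fy y_def[symmetric] algebra_simps power2_eq_square)
  have ut': "pd_t u (x, t) = 2 * t * R y" by (simp add: ut y_def)
  \<comment> \<open>The \<open>\<rho>\<^sup>2 / t\<^sup>2\<close> terms cancel between
    \<open>utt\<close> and the last term, the \<open>euler_x R\<close> terms between
    \<open>lap\<close> and \<open>et\<close>, and the dimension terms between \<open>lap\<close> and
    the last term. The coefficients of \<open>pd_t R y\<close> add up to
    \<open>4 * snd y\<close>.\<close>
  show ?thesis
    unfolding utt lap et eu ut' herm_lag_def y_def[symmetric] fy R_def[symmetric] using t
    by (simp add: field_simps power2_eq_square)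
qed

section \<open>Orthogonality forces the eigenvalue equation\<close>

theorem theorem7p12:
  fixes \<rho> \<mu> t :: real and n :: nat
    and u :: "(real ^ 'd::finite) \<times> real \<Rightarrow> real" and x :: "real ^ 'd"
  assumes "\<rho> > 0" and "\<mu> > - (1/2)"
    and "u \<in> V_even \<rho> (W_half \<rho> \<mu>) n"
    and "t \<noteq> 0"
  shows "(1 - \<rho>\<^sup>2 / t\<^sup>2) * pd_t (pd_t u) (x, t)
       + laplace_x u (x, t)
       + (2 / t) * euler_x (pd_t u) (x, t)
       - (2 / t) * (t\<^sup>2 - \<rho>\<^sup>2) * pd_t u (x, t)
       - 2 * euler_x u (x, t)
       + (1 / t) * (\<rho>\<^sup>2 / t\<^sup>2 + 2 * \<mu> + real CARD('d)) * pd_t u (x, t)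
       = - 2 * real n * u (x, t)"
proof -
  note \<rho>\<mu> = assms(1,2)
  have u: "u \<in> polys n" "\<And>x t. u (x, - t) = u (x, t)"
    and orth: "\<And>m q. m < n \<Longrightarrow> q \<in> polys m \<Longrightarrow> inner_W \<rho> (W_half \<rho> \<mu>) u q = 0"
    using assms(3) by (auto simp: V_even_def)
  obtain P where P: "wpoly 2 (int n) P" and uP: "u = (\<lambda>z. P (hyp_coords \<rho> z))"
    using even_poly_hyp_coords[OF u] by blast
  define L where "L f = integral\<^sup>L lborel (hyp_weighted \<rho> \<mu> f)" for f :: "(real ^ 'd) \<times> real \<Rightarrow> real"
  \<comment> \<open>Orthogonality carried over to \<open>P\<close>. For \<open>n = 0\<close> there
    is no \<open>m < n\<close>, but a polynomial of degree at most -1 is 0.\<close>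
  have orthP: "L (\<lambda>z. P z * q z) = 0" if q: "wpoly 2 (int n - 1) q" for q
  proof (cases "n = 0")
    case True
    then have "q = (\<lambda>_. 0)" using wpoly_negD[OF q] by simp
    then show ?thesis by (simp add: L_def hyp_weighted_def[abs_def])
  next
    case False
    then have "(\<lambda>z. q (hyp_coords \<rho> z)) \<in> polys (n - 1)"
      using wpoly_hyp_coords[OF q] by (simp add: polys_iff_wpoly of_nat_diff)
    then have "inner_W \<rho> (W_half \<rho> \<mu>) u (\<lambda>z. q (hyp_coords \<rho> z)) = 0"
      using orth[of "n - 1"] False by simp
    then show ?thesis
      by (simp add: inner_W_def set_lebesgue_integral_def L_def hyp_weighted_def[abs_def] uP)
  qed
  define v where "v z = herm_lag \<mu> P z + 2 * real n * P z" for z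
  have v: "wpoly 2 (int n - 1) v"
    using herm_lag_degree[OF P, of \<mu>] by (simp add: v_def[abs_def])
  define q where "q z = herm_lag \<mu> v z + 2 * real n * v z" for z
  have q: "wpoly 2 (int n - 1) q"
  proof -
    \<comment> \<open>Writing \<open>2 * n\<close> as \<open>2 * (n - 1) + 2\<close> makes
      \<open>herm_lag_degree\<close> applicable to \<open>v\<close>, whose degree bound is
      \<open>n - 1\<close>.\<close>
    have "wpoly 2 (int n - 1) (\<lambda>z. (herm_lag \<mu> v z + 2 * of_int (int n - 1) * v z) + 2 * v z)"
      by (intro wpoly.add wpoly_cmult v wpoly_mono[OF herm_lag_degree[OF v]]) simp
    then show ?thesis by (simp add: q_def[abs_def] algebra_simps)
  qed
  \<comment> \<open>The first part integrates to 0 by symmetry, the second by orthogonality of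
    \<open>P\<close> to the lower-degree \<open>q\<close>.\<close>
  have split: "(\<lambda>z. v z * v z) = (\<lambda>z. (v z * herm_lag \<mu> P z - P z * herm_lag \<mu> v z) + P z * q z)"
    by (rule ext) (simp add: v_def q_def algebra_simps)
  have "L (\<lambda>z. v z * v z) = 0 + L (\<lambda>z. P z * q z)"
    unfolding L_def split hyp_weighted_add[of _ _ "\<lambda>z. v z * herm_lag \<mu> P z - P z * herm_lag \<mu> v z"]
    using herm_lag_symmetric[OF \<rho>\<mu> P v] wpoly_mult[OF P _ q]
    by (subst Bochner_Integration.integral_add)
      (auto simp: has_bochner_integral_iff intro!: integrable_hyp_weighted[OF \<rho>\<mu>])
  then have "L (\<lambda>z. v z * v z) = 0" using orthP[OF q] by simp
  then have "v z = 0" for z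
    unfolding L_def by (rule hyp_norm_eq_0[OF \<rho>\<mu> v])
  then have "herm_lag \<mu> P (hyp_coords \<rho> (x, t)) = - 2 * real n * P (hyp_coords \<rho> (x, t))"
    by (simp add: v_def add_eq_0_iff2)
  then show ?thesis
    unfolding hyp_operator_hyp_coords[OF P assms(4) uP] by (simp add: uP)
qed

end
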